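(* Let $(\mathfrak{g},[\cdot,\cdot],\delta_\mathfrak{g})$ be a Lie bialgebra over $k$ that is a subspace of codimension one in a vector space $E$, and let $V$ be a complement of $\mathfrak{g}$ in $E$. Then there are bijections $$BExtd(E,\mathfrak{g})\cong\mathcal{HBI}^2_\mathfrak{g}(V,\mathfrak{g})\cong\mathcal{FLB}(\mathfrak{g},\delta_\mathfrak{g})/\equiv .$$
   Context: $k$ is a field of characteristic $0$, $k^*=k\setminus\{0\}$; all vector spaces and (multi)linear maps are over $k$. $I$ denotes the identity map. A Lie coalgebra $(\mathfrak{g},\delta_\mathfrak{g})$ is a vector space with a linear map $\delta_\mathfrak{g}:\mathfrak{g}\to\mathfrak{g}\otimes\mathfrak{g}$ such that $\delta_\mathfrak{g}=-\tau\delta_\mathfrak{g}$ and $(I\otimes\delta_\mathfrak{g})\delta_\mathfrak{g}-\tau_{12}(I\otimes\delta_\mathfrak{g})\delta_\mathfrak{g}=(\delta_\mathfrak{g}\otimes I)\delta_\mathfrak{g}$, where $\tau(a\otimes b)=b\otimes a$, $\tau_{12}(a\otimes b\otimes c)=b\otimes a\otimes c$. A Lie bialgebra $(\mathfrak{g},[\cdot,\cdot],\delta_\mathfrak{g})$ is a Lie algebra that is also a Lie coalgebra, with $\delta_\mathfrak{g}([a,b])=a.\delta_\mathfrak{g}(b)-b.\delta_\mathfrak{g}(a)$ for all $a,b$, where $a.(b\otimes c)=[a,b]\otimes c+b\otimes[a,c]$. Homomorphisms of Lie bialgebras are linear maps that are both Lie algebra and Lie coalgebra homomorphisms ($\delta\varphi=(\varphi\otimes\varphi)\delta$).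 A Lie sub-bialgebra is a subspace with a Lie bialgebra structure such that the ambient bracket and co-bracket restrict to those of the subspace. $BExtd(E,\mathfrak{g})$: the set of equivalence classes of Lie bialgebra structures on $E$ containing $(\mathfrak{g},[\cdot,\cdot],\delta_\mathfrak{g})$ as a Lie sub-bialgebra, two such structures being equivalent if there is an isomorphism of Lie bialgebras between them whose restriction to $\mathfrak{g}$ is the identity. A Lie bialgebraic extending structure of $(\mathfrak{g},[\cdot,\cdot],\delta_\mathfrak{g})$ by $V$ is a system $(\lhd,\rhd,f,\{\cdot,\cdot\},\Delta_E,\Delta_V,\delta_V)$ of bilinear maps $\lhd:V\times\mathfrak{g}\to V$, $\rhd:V\times\mathfrak{g}\to\mathfrak{g}$, $f:V\times V\to\mathfrak{g}$, $\{\cdot,\cdot\}:V\times V\to V$ and linear maps $\Delta_E:V\to\mathfrak{g}\otimes V$, $\Delta_V:V\to\mathfrak{g}\otimes\mathfrak{g}$, $\delta_V:V\to V\otimes V$ such that $\mathfrak{g}\oplus V$ with $[a+x,b+y]=[a,b]+x\rhd b-y\rhd a+f(x,y)+x\lhd b-y\lhd a+\{x,y\}$ and $\delta_E(a+x)=\delta_\mathfrak{g}(a)+\Delta_E(x)-\tau\Delta_E(x)+\Delta_V(x)+\delta_V(x)$ ($a,b\in\mathfrak{g}$, $x,y\in V$) is a Lie bialgebra. $\mathcal{LBI}(\mathfrak{g},V)$ is the set of all of these. Two elements $(\lhd,\rhd,f,\{\cdot,\cdot\},\Delta_E,\Delta_V,\delta_V)$ and $(\lhd',\rhd',f',\{\cdot,\cdot\}',\Delta_E',\Delta_V',\delta_V')$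 of $\mathcal{LBI}(\mathfrak{g},V)$ are equivalent ($\equiv$) if there are a linear map $p:V\to\mathfrak{g}$ and a linear automorphism $q$ of $V$ such that for all $a\in\mathfrak{g}$, $x,y\in V$, writing $\bar x=q^{-1}(x)$, $\bar y=q^{-1}(y)$: $\delta_V'(x)=(q\otimes q)\delta_V(\bar x)$; $\Delta_E'(x)=(I\otimes q)\Delta_E(\bar x)+(p\otimes q)\delta_V(\bar x)$; $\Delta_V'(x)=(I\otimes p)\Delta_E(\bar x)-(p\otimes I)\tau\Delta_E(\bar x)+(p\otimes p)\delta_V(\bar x)+\Delta_V(\bar x)-\delta_\mathfrak{g}(p(\bar x))$; $x\lhd' a=q(\bar x\lhd a)$; $x\rhd' a=p(\bar x\lhd a)+\bar x\rhd a-[p(\bar x),a]$; $f'(x,y)=f(\bar x,\bar y)+p(\{\bar x,\bar y\})+[p(\bar x),p(\bar y)]-p(\bar x\lhd p(\bar y))-\bar x\rhd p(\bar y)+p(\bar y\lhd p(\bar x))+\bar y\rhd p(\bar x)$; $\{x,y\}'=q(\{\bar x,\bar y\})-q(\bar x\lhd p(\bar y))+q(\bar y\lhd p(\bar x))$. $\mathcal{HBI}^2_\mathfrak{g}(V,\mathfrak{g}):=\mathcal{LBI}(\mathfrak{g},V)/\equiv$. A flag datum of $(\mathfrak{g},[\cdot,\cdot],\delta_\mathfrak{g})$ is a 4-tuple $(\alpha,D,A,B)$ with $A\in\mathfrak{g}$, $B\in\mathfrak{g}\wedge\mathfrak{g}$ (skew-symmetric tensors in $\mathfrak{g}\otimes\mathfrak{g}$),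 and linear maps $\alpha:\mathfrak{g}\to k$, $D:\mathfrak{g}\to\mathfrak{g}$ such that for all $a,b\in\mathfrak{g}$, with $\delta_\mathfrak{g}(a)=\sum a_{(1)}\otimes a_{(2)}$: (i) $\alpha([a,b])=0$, $\delta_\mathfrak{g}(A)=0$, $[a,A]=\sum\alpha(a_{(2)})a_{(1)}$; (ii) $D([a,b])=[D(a),b]+[a,D(b)]+\alpha(a)D(b)-\alpha(b)D(a)$; (iii) $A\otimes B-\tau_{12}(A\otimes B)+B\otimes A+(I\otimes\delta_\mathfrak{g}-\tau_{12}(I\otimes\delta_\mathfrak{g})-\delta_\mathfrak{g}\otimes I)B=0$; (iv) $D(a)\otimes A-A\otimes D(a)+\alpha(a)B+a.B+\delta_\mathfrak{g}(D(a))-\sum D(a_{(1)})\otimes a_{(2)}-\sum a_{(1)}\otimes D(a_{(2)})=0$. $\mathcal{FLB}(\mathfrak{g},\delta_\mathfrak{g})$ is the set of all flag datums. Two flag datums $(\alpha,D,A,B)$ and $(\alpha',D',A',B')$ are equivalent ($\equiv$) if $\alpha'=\alpha$, $A'=A$ and there exist $U\in\mathfrak{g}$ and $\beta\in k^*$ such that $D(a)=[U,a]+\beta D'(a)-\alpha(a)U$ for all $a\in\mathfrak{g}$ and $B=\delta_\mathfrak{g}(U)+\beta B'+U\otimes A-A\otimes U$. *)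

theory Defs
  imports "HOL-Analysis.Product_Vector" "HOL-Library.Function_Algebras"
begin

section \<open>Tensor products over a field\<close>

text \<open>
  Vector spaces are types carrying an explicit scalar multiplication, as in
  \<open>HOL.Vector_Spaces\<close>. The tensor product of \<open>A\<close> and \<open>B\<close> is realised inside the linear dual of the
  space of bilinear forms on \<open>A \<times> B\<close>: the pure tensor of \<open>a\<close> and \<open>b\<close> is evaluation at \<open>(a, b)\<close>, and
  \<open>tensor_space\<close> is the span of the pure tensors. The universal property, for bilinear maps into an
  arbitrary vector space, is proved below. Dimensions may be infinite.
\<close>

definition bilin ::
  "('k::field \<Rightarrow> 'a::ab_group_add \<Rightarrow> 'a) \<Rightarrow> ('k \<Rightarrow> 'b::ab_group_add \<Rightarrow> 'b) \<Rightarrow>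
   ('k \<Rightarrow> 'c::ab_group_add \<Rightarrow> 'c) \<Rightarrow> ('a \<Rightarrow> 'b \<Rightarrow> 'c) \<Rightarrow> bool"
  where "bilin sA sB sC h \<longleftrightarrow>
    (\<forall>b. Vector_Spaces.linear sA sC (\<lambda>a. h a b)) \<and> (\<forall>a. Vector_Spaces.linear sB sC (h a))"

definition trilin_form ::
  "('k::field \<Rightarrow> 'a::ab_group_add \<Rightarrow> 'a) \<Rightarrow> ('a \<Rightarrow> 'a \<Rightarrow> 'a \<Rightarrow> 'k) \<Rightarrow> bool"
  where "trilin_form s \<phi> \<longleftrightarrow>
    (\<forall>b c. Vector_Spaces.linear s (*) (\<lambda>a. \<phi> a b c)) \<and>
    (\<forall>a c. Vector_Spaces.linear s (*) (\<lambda>b. \<phi> a b c)) \<and>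
    (\<forall>a b. Vector_Spaces.linear s (*) (\<lambda>c. \<phi> a b c))"

type_synonym ('k, 'a, 'b) tensor2 = "('a \<Rightarrow> 'b \<Rightarrow> 'k) \<Rightarrow> 'k"
type_synonym ('k, 'a) tensor3 = "('a \<Rightarrow> 'a \<Rightarrow> 'a \<Rightarrow> 'k) \<Rightarrow> 'k"

definition fscale :: "'k::field \<Rightarrow> ('f \<Rightarrow> 'k) \<Rightarrow> 'f \<Rightarrow> 'k"
  where "fscale c t = (\<lambda>\<phi>. c * t \<phi>)"

definition tensor ::
  "('k::field \<Rightarrow> 'a::ab_group_add \<Rightarrow> 'a) \<Rightarrow> ('k \<Rightarrow> 'b::ab_group_add \<Rightarrow> 'b) \<Rightarrow>
   'a \<Rightarrow> 'b \<Rightarrow> ('k, 'a, 'b) tensor2"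
  where "tensor sA sB a b = (\<lambda>\<phi>. if bilin sA sB (*) \<phi> then \<phi> a b else 0)"

definition tensor_space ::
  "('k::field \<Rightarrow> 'a::ab_group_add \<Rightarrow> 'a) \<Rightarrow> ('k \<Rightarrow> 'b::ab_group_add \<Rightarrow> 'b) \<Rightarrow>
   ('k, 'a, 'b) tensor2 set"
  where "tensor_space sA sB = module.span fscale {tensor sA sB a b | a b. True}"

text \<open>
  The linear map on the tensor product induced by a bilinear map \<open>h\<close>, that is
  \<open>\<Sum> a\<^sub>i \<otimes> b\<^sub>i \<mapsto> \<Sum> h a\<^sub>i b\<^sub>i\<close>; the value is determined by what linear forms do on it.
\<close>

definition tensor_lift ::
  "('k::field \<Rightarrow> 'c::ab_group_add \<Rightarrow> 'c) \<Rightarrow> ('a \<Rightarrow> 'b \<Rightarrow> 'c) \<Rightarrow> ('k, 'a, 'b) tensor2 \<Rightarrow> 'c"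
  where "tensor_lift sC h t =
    (THE w. \<forall>l. Vector_Spaces.linear sC (*) l \<longrightarrow> l w = t (\<lambda>a b. l (h a b)))"

text \<open>The map \<open>f \<otimes> g\<close>; the scalar multiplications are those of the codomains of \<open>f\<close> and \<open>g\<close>.\<close>

definition tensor_map ::
  "('k::field \<Rightarrow> 'c::ab_group_add \<Rightarrow> 'c) \<Rightarrow> ('k \<Rightarrow> 'd::ab_group_add \<Rightarrow> 'd) \<Rightarrow>
   ('a \<Rightarrow> 'c) \<Rightarrow> ('b \<Rightarrow> 'd) \<Rightarrow> ('k, 'a, 'b) tensor2 \<Rightarrow> ('k, 'c, 'd) tensor2"
  where "tensor_map sC sD f g t =
    (\<lambda>\<phi>. if bilin sC sD (*) \<phi> then t (\<lambda>a b. \<phi> (f a) (g b)) else 0)"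

definition flip :: "('k, 'a, 'b) tensor2 \<Rightarrow> ('k, 'b, 'a) tensor2"
  where "flip t = (\<lambda>\<phi>. t (\<lambda>a b. \<phi> b a))"

definition vec_tensor :: "('k::field \<Rightarrow> 'a::ab_group_add \<Rightarrow> 'a) \<Rightarrow>
   'a \<Rightarrow> ('k, 'a, 'a) tensor2 \<Rightarrow> ('k, 'a) tensor3"
  where "vec_tensor s a t = (\<lambda>\<phi>. if trilin_form s \<phi> then t (\<lambda>b c. \<phi> a b c) else 0)"

definition tensor_vec :: "('k::field \<Rightarrow> 'a::ab_group_add \<Rightarrow> 'a) \<Rightarrow>
   ('k, 'a, 'a) tensor2 \<Rightarrow> 'a \<Rightarrow> ('k, 'a) tensor3"
  where "tensor_vec s t c = (\<lambda>\<phi>. if trilin_form s \<phi> then t (\<lambda>a b. \<phi> a b c) else 0)"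

text \<open>\<open>id_tensor s d\<close> is \<open>I \<otimes> d\<close> and \<open>tensor_id s d\<close> is \<open>d \<otimes> I\<close>, for a linear map \<open>d\<close> into tensors.\<close>

definition id_tensor :: "('k::field \<Rightarrow> 'a::ab_group_add \<Rightarrow> 'a) \<Rightarrow>
   ('a \<Rightarrow> ('k, 'a, 'a) tensor2) \<Rightarrow> ('k, 'a, 'a) tensor2 \<Rightarrow> ('k, 'a) tensor3"
  where "id_tensor s d t =
    (\<lambda>\<phi>. if trilin_form s \<phi> then t (\<lambda>a b. d b (\<lambda>u v. \<phi> a u v)) else 0)"

definition tensor_id :: "('k::field \<Rightarrow> 'a::ab_group_add \<Rightarrow> 'a) \<Rightarrow>
   ('a \<Rightarrow> ('k, 'a, 'a) tensor2) \<Rightarrow> ('k, 'a, 'a) tensor2 \<Rightarrow> ('k, 'a) tensor3"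
  where "tensor_id s d t =
    (\<lambda>\<phi>. if trilin_form s \<phi> then t (\<lambda>a b. d a (\<lambda>u v. \<phi> u v b)) else 0)"

definition flip12 :: "('k, 'a) tensor3 \<Rightarrow> ('k, 'a) tensor3"
  where "flip12 t = (\<lambda>\<phi>. t (\<lambda>a b c. \<phi> b a c))"


subsection \<open>The constructions satisfy their defining properties\<close>

lemma vector_space_fscale: "vector_space (fscale :: 'k::field \<Rightarrow> ('f \<Rightarrow> 'k) \<Rightarrow> _)"
  by unfold_locales (auto simp: fscale_def fun_eq_iff algebra_simps)

lemma vector_space_mult: "vector_space ((*) :: 'k::field \<Rightarrow> 'k \<Rightarrow> 'k)"
  by unfold_locales (auto simp: algebra_simps)

lemma linear_iff: "Vector_Spaces.linear s t f \<longleftrightarrow> vector_space s \<and> vector_space t \<and>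
    (\<forall>x y. f (x + y) = f x + f y) \<and> (\<forall>c x. f (s c x) = t c (f x))"
  by (auto simp: Vector_Spaces.linear_def module_hom_def module_hom_axioms_def
      vector_space_def module_def)

lemma bilin_tensor:
  assumes "vector_space sA" "vector_space sB"
  shows "bilin sA sB fscale (tensor sA sB)"
  using assms vector_space_fscale
  by (auto simp: bilin_def linear_iff tensor_def fscale_def fun_eq_iff)

lemma tensor_map_tensor:
  assumes "Vector_Spaces.linear sA sC f" "Vector_Spaces.linear sB sD g"
  shows "tensor_map sC sD f g (tensor sA sB a b) = tensor sC sD (f a) (g b)"
  using assms by (auto simp: tensor_map_def tensor_def bilin_def linear_iff fun_eq_iff)

lemma flip_tensor: "flip (tensor sA sB a b) = tensor sB sA b a"
  by (auto simp: flip_def tensor_def bilin_def fun_eq_iff)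

lemma tensor_space_eval:
  assumes "t \<in> tensor_space sA sB"
  shows "\<exists>ts. t = (\<lambda>\<phi>. if bilin sA sB (*) \<phi> then (\<Sum>(c, a, b)\<leftarrow>ts. c * \<phi> a b) else 0)"
proof -
  interpret F: vector_space fscale by (rule vector_space_fscale)
  show ?thesis
    using assms unfolding tensor_space_def
  proof (induction rule: F.span_induct_alt)
    case base
    show ?case by (rule exI[of _ "[]"]) (auto simp: fun_eq_iff)
  next
    case (step c x y)
    then obtain a b ts where "x = tensor sA sB a b"
      and "y = (\<lambda>\<phi>. if bilin sA sB (*) \<phi> then (\<Sum>(c, a, b)\<leftarrow>ts. c * \<phi> a b) else 0)" by auto
    then show ?case
      by (intro exI[of _ "(c, a, b) # ts"]) (auto simp: fun_eq_iff fscale_def tensor_def)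
  qed
qed

lemma id_tensor_tensor:
  assumes "Vector_Spaces.linear s fscale d" "\<And>x. d x \<in> tensor_space s s"
  shows "id_tensor s d (tensor s s a b) = vec_tensor s a (d b)"
proof
  fix \<phi>
  show "id_tensor s d (tensor s s a b) \<phi> = vec_tensor s a (d b) \<phi>"
  proof (cases "trilin_form s \<phi>")
    case True
    have lin_l: "d y (\<phi> (x + x')) = d y (\<phi> x) + d y (\<phi> x')"
      "d y (\<phi> (s c x)) = c * d y (\<phi> x)" for x x' y c
    proof -
      obtain ts where ts: "d y = (\<lambda>\<phi>. if bilin s s (*) \<phi> then (\<Sum>(c, a, b)\<leftarrow>ts. c * \<phi> a b) else 0)"
        using tensor_space_eval[OF assms(2)] by blast
      have b: "bilin s s (*) (\<phi> x)" for x
        using True by (auto simp: trilin_form_def bilin_def)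
      have 1: "\<phi> (x + x') u v = \<phi> x u v + \<phi> x' u v" "\<phi> (s c x) u v = c * \<phi> x u v" for u v
        using True by (auto simp: trilin_form_def linear_iff)
      show "d y (\<phi> (x + x')) = d y (\<phi> x) + d y (\<phi> x')"
        by (simp add: ts b 1 split_def distrib_left sum_list_addf)
      show "d y (\<phi> (s c x)) = c * d y (\<phi> x)"
        by (simp add: ts b 1 split_def flip: sum_list_const_mult) (simp add: mult.left_commute)
    qed
    have "bilin s s (*) (\<lambda>a b. d b (\<phi> a))"
      using assms(1) lin_l by (auto simp: bilin_def linear_iff vector_space_mult fscale_def)
    with True show ?thesis by (simp add: id_tensor_def vec_tensor_def tensor_def)
  qed (simp add: id_tensor_def vec_tensor_def)
qed

lemma tensor_id_tensor:
  assumes "Vector_Spaces.linear s fscale d" "\<And>x. d x \<in> tensor_space s s"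
  shows "tensor_id s d (tensor s s a b) = tensor_vec s (d a) b"
proof
  fix \<phi>
  show "tensor_id s d (tensor s s a b) \<phi> = tensor_vec s (d a) b \<phi>"
  proof (cases "trilin_form s \<phi>")
    case True
    have lin_r: "d y (\<lambda>u v. \<phi> u v (x + x')) = d y (\<lambda>u v. \<phi> u v x) + d y (\<lambda>u v. \<phi> u v x')"
      "d y (\<lambda>u v. \<phi> u v (s c x)) = c * d y (\<lambda>u v. \<phi> u v x)" for x x' y c
    proof -
      obtain ts where ts: "d y = (\<lambda>\<phi>. if bilin s s (*) \<phi> then (\<Sum>(c, a, b)\<leftarrow>ts. c * \<phi> a b) else 0)"
        using tensor_space_eval[OF assms(2)] by blast
      have b: "bilin s s (*) (\<lambda>u v. \<phi> u v x)" for x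
        using True by (auto simp: trilin_form_def bilin_def)
      have 1: "\<phi> u v (x + x') = \<phi> u v x + \<phi> u v x'" "\<phi> u v (s c x) = c * \<phi> u v x" for u v
        using True by (auto simp: trilin_form_def linear_iff)
      have b': "bilin s s (*) (\<lambda>u v. \<phi> u v x + \<phi> u v x')" "bilin s s (*) (\<lambda>u v. c * \<phi> u v x)"
        using b[of "x + x'"] b[of "s c x"] by (simp_all add: 1)
      show "d y (\<lambda>u v. \<phi> u v (x + x')) = d y (\<lambda>u v. \<phi> u v x) + d y (\<lambda>u v. \<phi> u v x')"
        by (simp add: ts b b' 1 split_def distrib_left sum_list_addf)
      show "d y (\<lambda>u v. \<phi> u v (s c x)) = c * d y (\<lambda>u v. \<phi> u v x)"
        by (simp add: ts b b' 1 split_def flip: sum_list_const_mult) (simp add: mult.left_commute)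
    qed
    have "bilin s s (*) (\<lambda>a b. d a (\<lambda>u v. \<phi> u v b))"
      using assms(1) lin_r by (auto simp: bilin_def linear_iff vector_space_mult fscale_def)
    with True show ?thesis by (simp add: tensor_id_def tensor_vec_def tensor_def)
  qed (simp add: tensor_id_def tensor_vec_def)
qed

lemma flip12_pure:
  "flip12 (vec_tensor s a (tensor s s b c)) = vec_tensor s b (tensor s s a c)"
  by (auto simp: flip12_def vec_tensor_def tensor_def trilin_form_def bilin_def fun_eq_iff)

lemma linear_forms_separate:
  fixes sC :: "'k::field \<Rightarrow> 'c::ab_group_add \<Rightarrow> 'c"
  assumes "vector_space sC" and eq: "\<And>l. Vector_Spaces.linear sC (*) l \<Longrightarrow> l w = l w'"
  shows "w = w'"
proof (rule ccontr)
  assume "w \<noteq> w'"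
  interpret P: vector_space_pair sC "(*)"
    by (simp add: vector_space_pair_def assms(1) vector_space_mult)
  have "P.vs1.independent {w - w'}" using \<open>w \<noteq> w'\<close> by simp
  from P.linear_independent_extend[OF this, of "\<lambda>_. 1"]
  obtain l where l: "Vector_Spaces.linear sC (*) l" "l (w - w') = 1" by auto
  then have "l w - l w' = 1" by (metis P.linear_diff)
  with eq[OF l(1)] show False by simp
qed

lemma tensor_lift_char:
  assumes h: "bilin sA sB sC h" and t: "t \<in> tensor_space sA sB"
    and l: "Vector_Spaces.linear sC (*) l"
  shows "l (tensor_lift sC h t) = t (\<lambda>a b. l (h a b))"
proof -
  have vs: "vector_space sC" using h by (simp add: bilin_def linear_iff)
  obtain ts where ts: "t = (\<lambda>\<phi>. if bilin sA sB (*) \<phi> then (\<Sum>(c, a, b)\<leftarrow>ts. c * \<phi> a b) else 0)"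
    using tensor_space_eval[OF t] by blast
  let ?w = "\<Sum>(c, a, b)\<leftarrow>ts. sC c (h a b)"
  have *: "l ?w = t (\<lambda>a b. l (h a b))" if l: "Vector_Spaces.linear sC (*) l" for l
  proof -
    have l0: "l 0 = 0" using l by (metis linear_iff add_cancel_right_right)
    have "bilin sA sB (*) (\<lambda>a b. l (h a b))"
      using h l by (auto simp: bilin_def linear_iff)
    moreover have "l ?w = (\<Sum>(c, a, b)\<leftarrow>ts. c * l (h a b))"
      using l l0 by (induction ts) (auto simp: linear_iff)
    ultimately show ?thesis by (simp add: ts)
  qed
  have "\<forall>l. Vector_Spaces.linear sC (*) l \<longrightarrow> l (tensor_lift sC h t) = t (\<lambda>a b. l (h a b))"
    unfolding tensor_lift_def
  proof (rule theI)
    show "\<forall>l. Vector_Spaces.linear sC (*) l \<longrightarrow> l ?w = t (\<lambda>a b. l (h a b))" using * by blast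
    show "w' = ?w" if "\<forall>l. Vector_Spaces.linear sC (*) l \<longrightarrow> l w' = t (\<lambda>a b. l (h a b))" for w'
      by (rule linear_forms_separate[OF vs]) (use that * in metis)
  qed
  with l show ?thesis by blast
qed

text \<open>
  The universal property: \<open>tensor_lift sC h\<close> is linear on the tensor product and extends \<open>h\<close>.
  Uniqueness is clear, since the pure tensors span.
\<close>

theorem tensor_lift_universal:
  assumes h: "bilin sA sB sC h"
  shows "tensor_lift sC h (tensor sA sB a b) = h a b"
    and "\<lbrakk>t \<in> tensor_space sA sB; u \<in> tensor_space sA sB\<rbrakk> \<Longrightarrow>
      tensor_lift sC h (t + u) = tensor_lift sC h t + tensor_lift sC h u"
    and "t \<in> tensor_space sA sB \<Longrightarrow>
      tensor_lift sC h (fscale c t) = sC c (tensor_lift sC h t)"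
proof -
  interpret F: vector_space fscale by (rule vector_space_fscale)
  have vs: "vector_space sC" using h by (simp add: bilin_def linear_iff)
  note sep = linear_forms_separate[OF vs] and ch = tensor_lift_char[OF h]
  show "tensor_lift sC h (tensor sA sB a b) = h a b"
  proof (rule sep)
    fix l assume l: "Vector_Spaces.linear sC (*) l"
    have t: "tensor sA sB a b \<in> tensor_space sA sB"
      unfolding tensor_space_def by (rule F.span_base) blast
    have "bilin sA sB (*) (\<lambda>a b. l (h a b))"
      using h l by (auto simp: bilin_def linear_iff)
    then show "l (tensor_lift sC h (tensor sA sB a b)) = l (h a b)"
      by (simp add: ch[OF t l]) (simp add: tensor_def)
  qed
  show "tensor_lift sC h (t + u) = tensor_lift sC h t + tensor_lift sC h u"
    if "t \<in> tensor_space sA sB" "u \<in> tensor_space sA sB"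
  proof (rule sep)
    fix l assume l: "Vector_Spaces.linear sC (*) l"
    have "t + u \<in> tensor_space sA sB"
      using that unfolding tensor_space_def by (rule F.span_add)
    with that l show "l (tensor_lift sC h (t + u)) = l (tensor_lift sC h t + tensor_lift sC h u)"
      by (simp add: ch linear_iff[of sC "(*)" l, THEN iffD1, OF l])
  qed
  show "tensor_lift sC h (fscale c t) = sC c (tensor_lift sC h t)"
    if "t \<in> tensor_space sA sB"
  proof (rule sep)
    fix l assume l: "Vector_Spaces.linear sC (*) l"
    have "fscale c t \<in> tensor_space sA sB"
      using that unfolding tensor_space_def by (rule F.span_scale)
    with that l show "l (tensor_lift sC h (fscale c t)) = l (sC c (tensor_lift sC h t))"
      by (simp add: ch linear_iff[of sC "(*)" l, THEN iffD1, OF l]) (simp add: fscale_def)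
  qed
qed


section \<open>Lie bialgebras\<close>

definition lie_algebra ::
  "('k::field \<Rightarrow> 'a::ab_group_add \<Rightarrow> 'a) \<Rightarrow> ('a \<Rightarrow> 'a \<Rightarrow> 'a) \<Rightarrow> bool"
  where "lie_algebra s br \<longleftrightarrow>
    vector_space s \<and> bilin s s s br \<and> (\<forall>a. br a a = 0) \<and>
    (\<forall>a b c. br a (br b c) + br b (br c a) + br c (br a b) = 0)"

definition lie_coalgebra ::
  "('k::field \<Rightarrow> 'a::ab_group_add \<Rightarrow> 'a) \<Rightarrow> ('a \<Rightarrow> ('k, 'a, 'a) tensor2) \<Rightarrow> bool"
  where "lie_coalgebra s d \<longleftrightarrow>
    vector_space s \<and> Vector_Spaces.linear s fscale d \<and> (\<forall>a. d a \<in> tensor_space s s) \<and>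
    (\<forall>a. d a = - flip (d a)) \<and>
    (\<forall>a. id_tensor s d (d a) - flip12 (id_tensor s d (d a)) = tensor_id s d (d a))"

text \<open>The action \<open>a.(b \<otimes> c) = [a, b] \<otimes> c + b \<otimes> [a, c]\<close>.\<close>

definition ad_tensor ::
  "('k::field \<Rightarrow> 'a::ab_group_add \<Rightarrow> 'a) \<Rightarrow> ('a \<Rightarrow> 'a \<Rightarrow> 'a) \<Rightarrow>
   'a \<Rightarrow> ('k, 'a, 'a) tensor2 \<Rightarrow> ('k, 'a, 'a) tensor2"
  where "ad_tensor s br a t = tensor_map s s (br a) id t + tensor_map s s id (br a) t"

definition lie_bialgebra ::
  "('k::field \<Rightarrow> 'a::ab_group_add \<Rightarrow> 'a) \<Rightarrow> ('a \<Rightarrow> 'a \<Rightarrow> 'a) \<Rightarrow>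
   ('a \<Rightarrow> ('k, 'a, 'a) tensor2) \<Rightarrow> bool"
  where "lie_bialgebra s br d \<longleftrightarrow> lie_algebra s br \<and> lie_coalgebra s d \<and>
    (\<forall>a b. d (br a b) = ad_tensor s br a (d b) - ad_tensor s br b (d a))"

definition lie_bialgebra_hom ::
  "('k::field \<Rightarrow> 'a::ab_group_add \<Rightarrow> 'a) \<Rightarrow> ('a \<Rightarrow> 'a \<Rightarrow> 'a) \<Rightarrow> ('a \<Rightarrow> ('k, 'a, 'a) tensor2) \<Rightarrow>
   ('k \<Rightarrow> 'b::ab_group_add \<Rightarrow> 'b) \<Rightarrow> ('b \<Rightarrow> 'b \<Rightarrow> 'b) \<Rightarrow> ('b \<Rightarrow> ('k, 'b, 'b) tensor2) \<Rightarrow>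
   ('a \<Rightarrow> 'b) \<Rightarrow> bool"
  where "lie_bialgebra_hom s br d s' br' d' \<phi> \<longleftrightarrow>
    Vector_Spaces.linear s s' \<phi> \<and>
    (\<forall>a b. \<phi> (br a b) = br' (\<phi> a) (\<phi> b)) \<and>
    (\<forall>a. d' (\<phi> a) = tensor_map s' s' \<phi> \<phi> (d a))"


section \<open>Extensions of a Lie bialgebra to a larger space\<close>

text \<open>
  A subspace of \<open>E\<close> is presented by an injective linear map \<open>i\<close> into \<open>E\<close>, so that it is itself a type.
\<close>

definition subspace_embedding ::
  "('k::field \<Rightarrow> 'g::ab_group_add \<Rightarrow> 'g) \<Rightarrow> ('k \<Rightarrow> 'e::ab_group_add \<Rightarrow> 'e) \<Rightarrow> ('g \<Rightarrow> 'e) \<Rightarrow> bool"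
  where "subspace_embedding sG sE i \<longleftrightarrow> Vector_Spaces.linear sG sE i \<and> inj i"

definition complementary ::
  "('k::field \<Rightarrow> 'e::ab_group_add \<Rightarrow> 'e) \<Rightarrow> 'e set \<Rightarrow> 'e set \<Rightarrow> bool"
  where "complementary s W C \<longleftrightarrow> module.subspace s W \<and> module.subspace s C \<and>
    W \<inter> C = {0} \<and> {w + c | w c. w \<in> W \<and> c \<in> C} = UNIV"

definition codimension_one ::
  "('k::field \<Rightarrow> 'e::ab_group_add \<Rightarrow> 'e) \<Rightarrow> 'e set \<Rightarrow> bool"
  where "codimension_one s W \<longleftrightarrow> (\<exists>C. complementary s W C \<and> vector_space.dim s C = 1)"

definition ext_structures ::
  "('k::field \<Rightarrow> 'g::ab_group_add \<Rightarrow> 'g) \<Rightarrow> ('g \<Rightarrow> 'g \<Rightarrow> 'g) \<Rightarrow> ('g \<Rightarrow> ('k, 'g, 'g) tensor2) \<Rightarrow>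
   ('k \<Rightarrow> 'e::ab_group_add \<Rightarrow> 'e) \<Rightarrow> ('g \<Rightarrow> 'e) \<Rightarrow>
   (('e \<Rightarrow> 'e \<Rightarrow> 'e) \<times> ('e \<Rightarrow> ('k, 'e, 'e) tensor2)) set"
  where "ext_structures sG brG dG sE i =
    {(br, d). lie_bialgebra sE br d \<and> lie_bialgebra_hom sG brG dG sE br d i}"

definition ext_equiv ::
  "('k::field \<Rightarrow> 'g::ab_group_add \<Rightarrow> 'g) \<Rightarrow> ('g \<Rightarrow> 'g \<Rightarrow> 'g) \<Rightarrow> ('g \<Rightarrow> ('k, 'g, 'g) tensor2) \<Rightarrow>
   ('k \<Rightarrow> 'e::ab_group_add \<Rightarrow> 'e) \<Rightarrow> ('g \<Rightarrow> 'e) \<Rightarrow>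
   (('e \<Rightarrow> 'e \<Rightarrow> 'e) \<times> ('e \<Rightarrow> ('k, 'e, 'e) tensor2)) rel"
  where "ext_equiv sG brG dG sE i =
    {((br, d), (br', d')).
      (br, d) \<in> ext_structures sG brG dG sE i \<and> (br', d') \<in> ext_structures sG brG dG sE i \<and>
      (\<exists>\<phi>. lie_bialgebra_hom sE br d sE br' d' \<phi> \<and> bij \<phi> \<and> (\<forall>a. \<phi> (i a) = i a))}"

definition BExtd ::
  "('k::field \<Rightarrow> 'g::ab_group_add \<Rightarrow> 'g) \<Rightarrow> ('g \<Rightarrow> 'g \<Rightarrow> 'g) \<Rightarrow> ('g \<Rightarrow> ('k, 'g, 'g) tensor2) \<Rightarrow>
   ('k \<Rightarrow> 'e::ab_group_add \<Rightarrow> 'e) \<Rightarrow> ('g \<Rightarrow> 'e) \<Rightarrow>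
   (('e \<Rightarrow> 'e \<Rightarrow> 'e) \<times> ('e \<Rightarrow> ('k, 'e, 'e) tensor2)) set set"
  where "BExtd sG brG dG sE i = ext_structures sG brG dG sE i // ext_equiv sG brG dG sE i"


section \<open>Lie bialgebraic extending structures\<close>

text \<open>
  The fields are, in order, \<open>\<lhd>\<close>, \<open>\<rhd>\<close>, \<open>f\<close>, \<open>{\<cdot>,\<cdot>}\<close>, \<open>\<Delta>\<^sub>E\<close>, \<open>\<Delta>\<^sub>V\<close>, \<open>\<delta>\<^sub>V\<close>.
\<close>

record ('k, 'g, 'v) ext_system =
  ract :: "'v \<Rightarrow> 'g \<Rightarrow> 'v"
  lact :: "'v \<Rightarrow> 'g \<Rightarrow> 'g"
  cocyc :: "'v \<Rightarrow> 'v \<Rightarrow> 'g"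
  brV :: "'v \<Rightarrow> 'v \<Rightarrow> 'v"
  DelE :: "'v \<Rightarrow> ('k, 'g, 'v) tensor2"
  DelV :: "'v \<Rightarrow> ('k, 'g, 'g) tensor2"
  delV :: "'v \<Rightarrow> ('k, 'v, 'v) tensor2"

text \<open>The direct sum \<open>\<gg> \<oplus> V\<close> is the product type with componentwise scaling.\<close>

abbreviation sum_scale ::
  "('k::field \<Rightarrow> 'g::ab_group_add \<Rightarrow> 'g) \<Rightarrow> ('k \<Rightarrow> 'v::ab_group_add \<Rightarrow> 'v) \<Rightarrow>
   'k \<Rightarrow> 'g \<times> 'v \<Rightarrow> 'g \<times> 'v"
  where "sum_scale sG sV \<equiv> module_prod.scale sG sV"

fun sum_bracket ::
  "('g::ab_group_add \<Rightarrow> 'g \<Rightarrow> 'g) \<Rightarrow> ('k, 'g, 'v::ab_group_add) ext_system \<Rightarrow>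
   'g \<times> 'v \<Rightarrow> 'g \<times> 'v \<Rightarrow> 'g \<times> 'v"
  where "sum_bracket brG \<Omega> (a, x) (b, y) =
    (brG a b + lact \<Omega> x b - lact \<Omega> y a + cocyc \<Omega> x y, ract \<Omega> x b - ract \<Omega> y a + brV \<Omega> x y)"

fun sum_cobracket ::
  "('k::field \<Rightarrow> 'g::ab_group_add \<Rightarrow> 'g) \<Rightarrow> ('g \<Rightarrow> ('k, 'g, 'g) tensor2) \<Rightarrow>
   ('k \<Rightarrow> 'v::ab_group_add \<Rightarrow> 'v) \<Rightarrow> ('k, 'g, 'v) ext_system \<Rightarrow>
   'g \<times> 'v \<Rightarrow> ('k, 'g \<times> 'v, 'g \<times> 'v) tensor2"
  where "sum_cobracket sG dG sV \<Omega> (a, x) =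
    (let s = sum_scale sG sV; iG = (\<lambda>a. (a, 0)); iV = (\<lambda>x. (0, x)) in
     tensor_map s s iG iG (dG a)
     + tensor_map s s iG iV (DelE \<Omega> x) - flip (tensor_map s s iG iV (DelE \<Omega> x))
     + tensor_map s s iG iG (DelV \<Omega> x) + tensor_map s s iV iV (delV \<Omega> x))"

definition LBI ::
  "('k::field \<Rightarrow> 'g::ab_group_add \<Rightarrow> 'g) \<Rightarrow> ('g \<Rightarrow> 'g \<Rightarrow> 'g) \<Rightarrow> ('g \<Rightarrow> ('k, 'g, 'g) tensor2) \<Rightarrow>
   ('k \<Rightarrow> 'v::ab_group_add \<Rightarrow> 'v) \<Rightarrow> ('k, 'g, 'v) ext_system set"
  where "LBI sG brG dG sV = {\<Omega>.
    bilin sV sG sV (ract \<Omega>) \<and> bilin sV sG sG (lact \<Omega>) \<and>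
    bilin sV sV sG (cocyc \<Omega>) \<and> bilin sV sV sV (brV \<Omega>) \<and>
    Vector_Spaces.linear sV fscale (DelE \<Omega>) \<and> (\<forall>x. DelE \<Omega> x \<in> tensor_space sG sV) \<and>
    Vector_Spaces.linear sV fscale (DelV \<Omega>) \<and> (\<forall>x. DelV \<Omega> x \<in> tensor_space sG sG) \<and>
    Vector_Spaces.linear sV fscale (delV \<Omega>) \<and> (\<forall>x. delV \<Omega> x \<in> tensor_space sV sV) \<and>
    lie_bialgebra (sum_scale sG sV) (sum_bracket brG \<Omega>) (sum_cobracket sG dG sV \<Omega>)}"

definition LBI_equiv ::
  "('k::field \<Rightarrow> 'g::ab_group_add \<Rightarrow> 'g) \<Rightarrow> ('g \<Rightarrow> 'g \<Rightarrow> 'g) \<Rightarrow> ('g \<Rightarrow> ('k, 'g, 'g) tensor2) \<Rightarrow>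
   ('k \<Rightarrow> 'v::ab_group_add \<Rightarrow> 'v) \<Rightarrow> ('k, 'g, 'v) ext_system rel"
  where "LBI_equiv sG brG dG sV = {(\<Omega>, \<Omega>').
    \<Omega> \<in> LBI sG brG dG sV \<and> \<Omega>' \<in> LBI sG brG dG sV \<and>
    (\<exists>p q. Vector_Spaces.linear sV sG p \<and> Vector_Spaces.linear sV sV q \<and> bij q \<and>
      (\<forall>a x y. let x' = inv q x; y' = inv q y in
        delV \<Omega>' x = tensor_map sV sV q q (delV \<Omega> x') \<and>
        DelE \<Omega>' x = tensor_map sG sV id q (DelE \<Omega> x') + tensor_map sG sV p q (delV \<Omega> x') \<and>
        DelV \<Omega>' x = tensor_map sG sG id p (DelE \<Omega> x') - tensor_map sG sG p id (flip (DelE \<Omega> x'))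
          + tensor_map sG sG p p (delV \<Omega> x') + DelV \<Omega> x' - dG (p x') \<and>
        ract \<Omega>' x a = q (ract \<Omega> x' a) \<and>
        lact \<Omega>' x a = p (ract \<Omega> x' a) + lact \<Omega> x' a - brG (p x') a \<and>
        cocyc \<Omega>' x y = cocyc \<Omega> x' y' + p (brV \<Omega> x' y') + brG (p x') (p y')
          - p (ract \<Omega> x' (p y')) - lact \<Omega> x' (p y') + p (ract \<Omega> y' (p x')) + lact \<Omega> y' (p x') \<and>
        brV \<Omega>' x y = q (brV \<Omega> x' y') - q (ract \<Omega> x' (p y')) + q (ract \<Omega> y' (p x'))))}"

definition HBI2 ::
  "('k::field \<Rightarrow> 'g::ab_group_add \<Rightarrow> 'g) \<Rightarrow> ('g \<Rightarrow> 'g \<Rightarrow> 'g) \<Rightarrow> ('g \<Rightarrow> ('k, 'g, 'g) tensor2) \<Rightarrow>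
   ('k \<Rightarrow> 'v::ab_group_add \<Rightarrow> 'v) \<Rightarrow> ('k, 'g, 'v) ext_system set set"
  where "HBI2 sG brG dG sV = LBI sG brG dG sV // LBI_equiv sG brG dG sV"


section \<open>Flag datums\<close>

text \<open>
  In Sweedler notation, \<open>\<Sum> \<alpha>(a\<^sub>2) a\<^sub>1\<close> is the lift of the bilinear map \<open>(u, v) \<mapsto> \<alpha>(v) u\<close> evaluated
  at the cobracket of \<open>a\<close>.
\<close>

definition FLB ::
  "('k::field \<Rightarrow> 'g::ab_group_add \<Rightarrow> 'g) \<Rightarrow> ('g \<Rightarrow> 'g \<Rightarrow> 'g) \<Rightarrow> ('g \<Rightarrow> ('k, 'g, 'g) tensor2) \<Rightarrow>
   (('g \<Rightarrow> 'k) \<times> ('g \<Rightarrow> 'g) \<times> 'g \<times> ('k, 'g, 'g) tensor2) set"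
  where "FLB s br d = {(\<alpha>, D, A, B).
    B \<in> tensor_space s s \<and> flip B = - B \<and>
    Vector_Spaces.linear s (*) \<alpha> \<and> Vector_Spaces.linear s s D \<and>
    (\<forall>a b. \<alpha> (br a b) = 0) \<and> d A = 0 \<and>
    (\<forall>a. br a A = tensor_lift s (\<lambda>u v. s (\<alpha> v) u) (d a)) \<and>
    (\<forall>a b. D (br a b) = br (D a) b + br a (D b) + s (\<alpha> a) (D b) - s (\<alpha> b) (D a)) \<and>
    vec_tensor s A B - flip12 (vec_tensor s A B) + tensor_vec s B A
      + (id_tensor s d B - flip12 (id_tensor s d B) - tensor_id s d B) = 0 \<and>
    (\<forall>a. tensor s s (D a) A - tensor s s A (D a) + fscale (\<alpha> a) B + ad_tensor s br a B
      + d (D a) - tensor_map s s D id (d a) - tensor_map s s id D (d a) = 0)}"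

definition FLB_equiv ::
  "('k::field \<Rightarrow> 'g::ab_group_add \<Rightarrow> 'g) \<Rightarrow> ('g \<Rightarrow> 'g \<Rightarrow> 'g) \<Rightarrow> ('g \<Rightarrow> ('k, 'g, 'g) tensor2) \<Rightarrow>
   (('g \<Rightarrow> 'k) \<times> ('g \<Rightarrow> 'g) \<times> 'g \<times> ('k, 'g, 'g) tensor2) rel"
  where "FLB_equiv s br d = {((\<alpha>, D, A, B), (\<alpha>', D', A', B')).
    (\<alpha>, D, A, B) \<in> FLB s br d \<and> (\<alpha>', D', A', B') \<in> FLB s br d \<and>
    \<alpha>' = \<alpha> \<and> A' = A \<and>
    (\<exists>U \<beta>. \<beta> \<noteq> 0 \<and>
      (\<forall>a. D a = br U a + s \<beta> (D' a) - s (\<alpha> a) U) \<and>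
      B = d U + fscale \<beta> B' + tensor s s U A - tensor s s A U)}"

end

theory Submission
  imports Defs
begin

text \<open>
  A Lie bialgebra structure on \<open>E\<close> extending that of \<open>\<gg>\<close> is transported along
  \<open>\<gg> \<times> V \<rightarrow> E\<close>, \<open>(a, x) \<mapsto> i a + j x\<close>, and then split into components; skew-symmetry of the
  cobracket means that its \<open>V \<otimes> \<gg>\<close> component is determined by the \<open>\<gg> \<otimes> V\<close> component. An
  automorphism of \<open>\<gg> \<times> V\<close> fixing \<open>\<gg>\<close> is a shear \<open>(a, x) \<mapsto> (a + p x, q x)\<close>, and comparing
  components turns the condition of being a homomorphism into the equivalence of extending
  structures. If \<open>V\<close> is spanned by one vector \<open>e\<close>, alternation kills \<open>f\<close>, \<open>{\<cdot>,\<cdot>}\<close> and (as \<open>2 \<noteq> 0\<close>)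
  \<open>\<delta>\<^sub>V\<close>, so that only \<open>x \<lhd> a = \<alpha>(a) x\<close>, \<open>e \<rhd> a = D(a)\<close>, \<open>\<Delta>\<^sub>E(x) = A \<otimes> x\<close> and \<open>\<Delta>\<^sub>V(e) = B\<close> remain;
  the Lie bialgebra axioms on \<open>\<gg> \<oplus> k e\<close> become the axioms of a flag datum, and the shear with
  \<open>p e = U\<close>, \<open>q e = \<beta> e\<close> gives the equivalence of flag datums.
\<close>

text \<open>A tensor is a functional that is 0 off the bilinear forms, so most identities are proved
  by evaluating both sides on an arbitrary form, without bases. The price is membership: additivity
  of \<open>t\<close> in the form and the identity law for \<open>tensor_map\<close> are available
  for elements of \<open>tensor_space\<close>, so membership facts accompany nearly every step.
  Three-fold tensors are tested on trilinear forms in the same way, and a form that sees only one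
  summand of the triple tensor product isolates one component of the co-Jacobi identity.

  On a line the axioms need testing only where e meets \<gg>: Jacobi on a, b, e, compatibility on a,
  e, and co-Jacobi at e. Everything else is inherited from \<gg> or follows because any two vectors
  of V are proportional to e.

  The maps on representatives run from flag datums to systems and from systems to structures on E.
  In these directions they are given by formulas and are onto, which is what the lemma on quotients
  asks for.\<close>

section \<open>Quotients\<close>

text \<open>
  \<open>R\<close> and \<open>S\<close> need not be equivalence relations: \<open>R\<close> is the preimage of \<open>S\<close>, so taking images
  and preimages of the sets \<open>R `` {x}\<close> and \<open>S `` {y}\<close> is mutually inverse even if \<open>T\<close> is not injective.
\<close>

lemma bij_betw_image_quotients:
  assumes "T ` X = Y" "R \<subseteq> X \<times> X" "S \<subseteq> Y \<times> Y"
    and RS: "\<And>x x'. x \<in> X \<Longrightarrow> x' \<in> X \<Longrightarrow> (x, x') \<in> R \<longleftrightarrow> (T x, T x') \<in> S"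
  shows "bij_betw ((`) T) (X // R) (Y // S)"
proof -
  have image: "T ` (R `` {x}) = S `` {T x}" if "x \<in> X" for x
  proof
    show "T ` (R `` {x}) \<subseteq> S `` {T x}"
      using assms(2) RS that by blast
    show "S `` {T x} \<subseteq> T ` (R `` {x})"
    proof
      fix y assume y: "y \<in> S `` {T x}"
      then obtain x' where "x' \<in> X" "y = T x'"
        using assms(1,3) by blast
      then show "y \<in> T ` (R `` {x})"
        using y RS that by blast
    qed
  qed
  have preimage: "R `` {x} = {x' \<in> X. T x' \<in> S `` {T x}}" if "x \<in> X" for x
    using assms(2) RS that by blast
  show ?thesis
    unfolding bij_betw_def
  proof
    show "inj_on ((`) T) (X // R)"
    proof (rule inj_onI)
      fix c c' assume "c \<in> X // R" "c' \<in> X // R" and eq: "T ` c = T ` c'"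
      then obtain x x' where x: "x \<in> X" "c = R `` {x}" "x' \<in> X" "c' = R `` {x'}"
        by (auto simp: quotient_def)
      with eq have "S `` {T x} = S `` {T x'}"
        by (simp add: image)
      with x show "c = c'"
        by (simp add: preimage)
    qed
    show "(`) T ` (X // R) = Y // S"
    proof -
      have "(`) T ` (X // R) = (\<lambda>x. T ` (R `` {x})) ` X"
        by (auto simp: quotient_def)
      also have "\<dots> = (\<lambda>x. S `` {T x}) ` X"
        by (rule image_cong) (simp_all add: image)
      also have "\<dots> = Y // S"
        using assms(1) by (auto simp: quotient_def)
      finally show ?thesis .
    qed
  qed
qed

section \<open>Linear and multilinear maps\<close>

text \<open>Scalar multiplications are explicit arguments and many occur at once, so the standard
  rules are kept as facts with a linearity premise, discharged by \<open>OF\<close>, instead of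
  interpreting a locale for each pair of spaces.\<close>

lemmas linear_add = module_hom.add[OF module_hom_iff_linear[THEN iffD2]]
  and linear_scale = module_hom.scale[OF module_hom_iff_linear[THEN iffD2]]
  and linear_0 = module_hom.zero[OF module_hom_iff_linear[THEN iffD2]]
  and linear_neg = module_hom.neg[OF module_hom_iff_linear[THEN iffD2]]
  and linear_diff = module_hom.diff[OF module_hom_iff_linear[THEN iffD2]]

lemma linear_vector_spaces:
  assumes "Vector_Spaces.linear s t f"
  shows "vector_space s" "vector_space t"
  using assms by (simp_all add: linear_iff)

lemma linear_id: "vector_space s \<Longrightarrow> Vector_Spaces.linear s s id"
  by (simp add: linear_iff)

lemma linear_comp:
  "Vector_Spaces.linear s t f \<Longrightarrow> Vector_Spaces.linear t u g \<Longrightarrow>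
    Vector_Spaces.linear s u (\<lambda>x. g (f x))"
  by (simp add: linear_iff)

lemma bilin_fst: "bilin sA sB sC h \<Longrightarrow> Vector_Spaces.linear sA sC (\<lambda>a. h a b)"
  by (simp add: bilin_def)

lemma bilin_snd: "bilin sA sB sC h \<Longrightarrow> Vector_Spaces.linear sB sC (h a)"
  by (simp add: bilin_def)

lemma bilin_form_iff:
  "bilin sA sB (*) \<phi> \<longleftrightarrow> vector_space sA \<and> vector_space sB \<and>
    (\<forall>a a' b. \<phi> (a + a') b = \<phi> a b + \<phi> a' b) \<and> (\<forall>a b b'. \<phi> a (b + b') = \<phi> a b + \<phi> a b') \<and>
    (\<forall>c a b. \<phi> (sA c a) b = c * \<phi> a b) \<and> (\<forall>c a b. \<phi> a (sB c b) = c * \<phi> a b)"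
  by (auto simp: bilin_def linear_iff vector_space_mult)

lemma bilin_comp:
  assumes "bilin sC sD s \<phi>" "Vector_Spaces.linear sA sC f" "Vector_Spaces.linear sB sD g"
  shows "bilin sA sB s (\<lambda>a b. \<phi> (f a) (g b))"
  using assms by (simp add: bilin_def linear_iff)

lemma bilin_swap: "bilin sA sB s (\<lambda>a b. \<phi> b a) \<longleftrightarrow> bilin sB sA s \<phi>"
  by (auto simp: bilin_def)

lemma bilin_form_add:
  "bilin sA sB (*) \<phi> \<Longrightarrow> bilin sA sB (*) \<psi> \<Longrightarrow> bilin sA sB (*) (\<lambda>a b. \<phi> a b + \<psi> a b)"
  by (simp add: bilin_form_iff algebra_simps)

lemma bilin_form_scale: "bilin sA sB (*) \<phi> \<Longrightarrow> bilin sA sB (*) (\<lambda>a b. c * \<phi> a b)"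
  by (simp add: bilin_form_iff algebra_simps)

lemma trilin_form_bilin:
  assumes "trilin_form s \<phi>"
  shows "bilin s s (*) (\<phi> a)" "bilin s s (*) (\<lambda>b c. \<phi> b a c)" "bilin s s (*) (\<lambda>b c. \<phi> b c a)"
  using assms by (simp_all add: trilin_form_def bilin_def)

lemma trilin_form_comp:
  "trilin_form t \<phi> \<Longrightarrow> Vector_Spaces.linear s t f \<Longrightarrow> Vector_Spaces.linear s t g \<Longrightarrow>
    Vector_Spaces.linear s t h \<Longrightarrow> trilin_form s (\<lambda>a b c. \<phi> (f a) (g b) (h c))"
  by (simp add: trilin_form_def linear_iff)

lemma trilin_form_swap: "trilin_form s (\<lambda>a b c. \<phi> b a c) \<longleftrightarrow> trilin_form s \<phi>"
  by (auto simp: trilin_form_def)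

section \<open>Tensors as functionals on bilinear forms\<close>

lemma tensor_space_closed:
  shows tensor_in: "tensor sA sB a b \<in> tensor_space sA sB"
    and tensor_space_add: "t \<in> tensor_space sA sB \<Longrightarrow> u \<in> tensor_space sA sB \<Longrightarrow> t + u \<in> tensor_space sA sB"
    and tensor_space_diff: "t \<in> tensor_space sA sB \<Longrightarrow> u \<in> tensor_space sA sB \<Longrightarrow> t - u \<in> tensor_space sA sB"
    and tensor_space_0: "0 \<in> tensor_space sA sB"
    and tensor_space_scale: "t \<in> tensor_space sA sB \<Longrightarrow> fscale c t \<in> tensor_space sA sB"
proof -
  interpret F: vector_space fscale by (rule vector_space_fscale)
  show "tensor sA sB a b \<in> tensor_space sA sB"
    unfolding tensor_space_def by (rule F.span_base) blast
qed (auto simp: tensor_space_def vector_space_fscale[unfolded vector_space_def, folded module_def]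
      module.span_zero module.span_diff module.span_add module.span_scale)

lemma tensor_space_not_bilin: "t \<in> tensor_space sA sB \<Longrightarrow> \<not> bilin sA sB (*) \<phi> \<Longrightarrow> t \<phi> = 0"
  using tensor_space_eval by fastforce

text \<open>Both tensors take the default value 0 on functions that are not bilinear, so bilinear
  forms suffice to tell them apart.\<close>

lemma tensor_space_eqI:
  "t \<in> tensor_space sA sB \<Longrightarrow> u \<in> tensor_space sA sB \<Longrightarrow>
    (\<And>\<phi>. bilin sA sB (*) \<phi> \<Longrightarrow> t \<phi> = u \<phi>) \<Longrightarrow> t = u"
  by (rule ext) (metis tensor_space_not_bilin)

text \<open>A tensor is a function on functions; its linearity in the form comes from the
  presentation as a finite sum of evaluations.\<close>

lemma tensor_eval_add:
  assumes "t \<in> tensor_space sA sB" "bilin sA sB (*) \<phi>" "bilin sA sB (*) \<psi>"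
  shows "t (\<lambda>a b. \<phi> a b + \<psi> a b) = t \<phi> + t \<psi>"
proof -
  obtain ts where "t = (\<lambda>\<phi>. if bilin sA sB (*) \<phi> then (\<Sum>(c, a, b)\<leftarrow>ts. c * \<phi> a b) else 0)"
    using tensor_space_eval[OF assms(1)] by blast
  then show ?thesis
    using assms(2,3) by (simp add: bilin_form_add split_def distrib_left sum_list_addf)
qed

lemma tensor_eval_scale:
  assumes "t \<in> tensor_space sA sB" "bilin sA sB (*) \<phi>"
  shows "t (\<lambda>a b. c * \<phi> a b) = c * t \<phi>"
proof -
  obtain ts where "t = (\<lambda>\<phi>. if bilin sA sB (*) \<phi> then (\<Sum>(c, a, b)\<leftarrow>ts. c * \<phi> a b) else 0)"
    using tensor_space_eval[OF assms(1)] by blast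
  then show ?thesis
    using assms(2)
    by (simp add: bilin_form_scale split_def flip: sum_list_const_mult) (simp add: mult.left_commute)
qed

text \<open>If the zero form is bilinear, this is homogeneity with factor 0; otherwise one of the
  two spaces is not a vector space and the tensor takes its default value.\<close>

lemma tensor_eval_0: "t \<in> tensor_space sA sB \<Longrightarrow> t (\<lambda>a b. 0) = 0"
  using tensor_eval_scale[of t sA sB "\<lambda>a b. 0" 0] tensor_space_not_bilin[of t sA sB "\<lambda>a b. 0"]
  by fastforce

text \<open>The cases match the additivity and homogeneity rules of \<open>tensor_map\<close>,
  \<open>flip\<close> and \<open>tensor_lift\<close>, so a linear identity reduces to pure tensors
  by rewriting. Membership is supplied in the cases because the rules for \<open>tensor_lift\<close>
  ask for it.\<close>

lemma tensor_space_span_induct [consumes 1, case_names pure add scale]: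
  assumes "t \<in> tensor_space sA sB"
    and pure: "\<And>a b. P (tensor sA sB a b)"
    and add: "\<And>t u. t \<in> tensor_space sA sB \<Longrightarrow> u \<in> tensor_space sA sB \<Longrightarrow> P t \<Longrightarrow> P u \<Longrightarrow> P (t + u)"
    and scale: "\<And>c t. t \<in> tensor_space sA sB \<Longrightarrow> P t \<Longrightarrow> P (fscale c t)"
  shows "P t"
proof -
  interpret F: vector_space fscale by (rule vector_space_fscale)
  have "t \<in> tensor_space sA sB \<and> P t"
    using assms(1) unfolding tensor_space_def
  proof (induction t rule: F.span_induct_alt)
    case base
    \<comment> \<open>Zero is reached as 0 times a pure tensor, so it needs no case of its
      own.\<close>
    have "P (fscale 0 (tensor sA sB 0 0))"
      by (intro scale pure tensor_in)
    then have "P 0"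
      by (simp only: fscale_def mult_zero_left zero_fun_def)
    then show ?case
      using F.span_zero by blast
  next
    case (step c x y)
    then obtain a b where x: "x = tensor sA sB a b"
      by auto
    have "P (fscale c x)"
      unfolding x by (intro scale pure tensor_in)
    moreover have "fscale c x \<in> tensor_space sA sB" "y \<in> tensor_space sA sB"
      using step unfolding x by (simp_all only: tensor_space_scale tensor_in tensor_space_def[symmetric])
    ultimately show ?case
      using step add tensor_space_add unfolding tensor_space_def by blast
  qed
  then show ?thesis by simp
qed

lemma tensor_map_add: "tensor_map sC sD f g (t + u) = tensor_map sC sD f g t + tensor_map sC sD f g u"
  and tensor_map_diff: "tensor_map sC sD f g (t - u) = tensor_map sC sD f g t - tensor_map sC sD f g u"
  and tensor_map_neg: "tensor_map sC sD f g (- t) = - tensor_map sC sD f g t"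
  and tensor_map_0: "tensor_map sC sD f g 0 = 0"
  and tensor_map_scale: "tensor_map sC sD f g (fscale c t) = fscale c (tensor_map sC sD f g t)"
  by (auto simp: tensor_map_def fscale_def fun_eq_iff)

lemma flip_add: "flip (t + u) = flip t + flip u"
  and flip_diff: "flip (t - u) = flip t - flip u"
  and flip_0: "flip 0 = 0"
  and flip_scale: "flip (fscale c t) = fscale c (flip t)"
  by (auto simp: flip_def fscale_def fun_eq_iff)

lemma flip_tensor_map: "flip (tensor_map sC sD f g t) = tensor_map sD sC g f (flip t)"
  by (simp only: flip_def tensor_map_def bilin_swap[of sC sD])

lemma tensor_map_in:
  assumes "t \<in> tensor_space sA sB" "Vector_Spaces.linear sA sC f" "Vector_Spaces.linear sB sD g"
  shows "tensor_map sC sD f g t \<in> tensor_space sC sD"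
  using assms(1)
  by (induction t rule: tensor_space_span_induct)
    (simp_all only: tensor_map_tensor[OF assms(2,3)] tensor_map_add tensor_map_scale tensor_space_closed)

lemma flip_in: "t \<in> tensor_space sA sB \<Longrightarrow> flip t \<in> tensor_space sB sA"
  by (induction t rule: tensor_space_span_induct)
    (simp_all only: flip_tensor flip_add flip_scale tensor_space_closed)

text \<open>Pulling a form back twice is pulling it back along the composites. Linearity of the
  outer maps makes the pulled-back form pass the bilinearity test in the inner
  \<open>tensor_map\<close>.\<close>

lemma tensor_map_comp:
  assumes "Vector_Spaces.linear sC sE f" "Vector_Spaces.linear sD sF g"
  shows "tensor_map sE sF f g (tensor_map sC sD f' g' t)
    = tensor_map sE sF (\<lambda>a. f (f' a)) (\<lambda>b. g (g' b)) t"
  by (simp add: tensor_map_def fun_eq_iff bilin_comp[OF _ assms])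

lemma tensor_map_id: "t \<in> tensor_space sA sB \<Longrightarrow> tensor_map sA sB id id t = t"
  by (auto simp: tensor_map_def fun_eq_iff tensor_space_not_bilin)

lemma tensor_map_add_left:
  assumes "t \<in> tensor_space sA sB" "Vector_Spaces.linear sA sC f" "Vector_Spaces.linear sA sC f'"
    "Vector_Spaces.linear sB sD g"
  shows "tensor_map sC sD (\<lambda>a. f a + f' a) g t = tensor_map sC sD f g t + tensor_map sC sD f' g t"
proof
  fix \<phi>
  show "tensor_map sC sD (\<lambda>a. f a + f' a) g t \<phi> = (tensor_map sC sD f g t + tensor_map sC sD f' g t) \<phi>"
    using tensor_eval_add[OF assms(1) bilin_comp[OF _ assms(2,4)] bilin_comp[OF _ assms(3,4)], of \<phi> \<phi>]
    by (simp add: tensor_map_def linear_add[OF bilin_fst])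
qed

lemma tensor_map_add_right:
  assumes "t \<in> tensor_space sA sB" "Vector_Spaces.linear sA sC f" "Vector_Spaces.linear sB sD g"
    "Vector_Spaces.linear sB sD g'"
  shows "tensor_map sC sD f (\<lambda>b. g b + g' b) t = tensor_map sC sD f g t + tensor_map sC sD f g' t"
proof
  fix \<phi>
  show "tensor_map sC sD f (\<lambda>b. g b + g' b) t \<phi> = (tensor_map sC sD f g t + tensor_map sC sD f g' t) \<phi>"
    using tensor_eval_add[OF assms(1) bilin_comp[OF _ assms(2,3)] bilin_comp[OF _ assms(2,4)], of \<phi> \<phi>]
    by (simp add: tensor_map_def linear_add[OF bilin_snd])
qed

text \<open>Used to discard components: \<open>snd\<close> after \<open>iG\<close> and
  \<open>fst\<close> after \<open>iV\<close> are constantly 0.\<close>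

lemma tensor_map_zero:
  assumes "t \<in> tensor_space sA sB"
  shows "tensor_map sC sD (\<lambda>_. 0) g t = 0" "tensor_map sC sD f (\<lambda>_. 0) t = 0"
proof -
  have "t (\<lambda>a b. \<phi> 0 (g b)) = 0" "t (\<lambda>a b. \<phi> (f a) 0) = 0" if "bilin sC sD (*) \<phi>" for \<phi>
    by (simp_all add: linear_0[OF bilin_fst[OF that]] linear_0[OF bilin_snd[OF that]] tensor_eval_0[OF assms])
  then show "tensor_map sC sD (\<lambda>_. 0) g t = 0" "tensor_map sC sD f (\<lambda>_. 0) t = 0"
    by (auto simp: tensor_map_def fun_eq_iff)
qed

lemma vector_space_module: "vector_space s \<Longrightarrow> module s"
  by (simp add: vector_space_def module_def)

lemma tensor_map_scale_left:
  assumes "t \<in> tensor_space sA sB" "Vector_Spaces.linear sA sC f" "Vector_Spaces.linear sB sD g"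
  shows "tensor_map sC sD (\<lambda>a. sC c (f a)) g t = fscale c (tensor_map sC sD f g t)"
proof
  fix \<phi>
  show "tensor_map sC sD (\<lambda>a. sC c (f a)) g t \<phi> = fscale c (tensor_map sC sD f g t) \<phi>"
    using tensor_eval_scale[OF assms(1) bilin_comp[OF _ assms(2,3)], of \<phi> c]
    by (simp add: tensor_map_def linear_scale[OF bilin_fst] fscale_def)
qed

lemma tensor_map_scale_right:
  assumes "t \<in> tensor_space sA sB" "Vector_Spaces.linear sA sC f" "Vector_Spaces.linear sB sD g"
  shows "tensor_map sC sD f (\<lambda>b. sD c (g b)) t = fscale c (tensor_map sC sD f g t)"
proof
  fix \<phi>
  show "tensor_map sC sD f (\<lambda>b. sD c (g b)) t \<phi> = fscale c (tensor_map sC sD f g t) \<phi>"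
    using tensor_eval_scale[OF assms(1) bilin_comp[OF _ assms(2,3)], of \<phi> c]
    by (simp add: tensor_map_def linear_scale[OF bilin_snd] fscale_def)
qed

text \<open>These are the forms that I \<otimes> d and d \<otimes> I feed to their argument. Their
  bilinearity allows an argument built from \<open>tensor\<close> or \<open>tensor_map\<close> to be
  unfolded under \<open>id_tensor\<close> and \<open>tensor_id\<close>.\<close>

lemma bilin_id_tensor:
  assumes "Vector_Spaces.linear s fscale d" "\<And>x. d x \<in> tensor_space s s" "trilin_form s \<phi>"
  shows "bilin s s (*) (\<lambda>a b. d b (\<phi> a))" "bilin s s (*) (\<lambda>a b. d a (\<lambda>u v. \<phi> u v b))"
proof -
  have expand: "\<phi> (a + a') = (\<lambda>u v. \<phi> a u v + \<phi> a' u v)" "\<phi> (s c a) = (\<lambda>u v. c * \<phi> a u v)"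
    "(\<lambda>u v. \<phi> u v (a + a')) = (\<lambda>u v. \<phi> u v a + \<phi> u v a')"
    "(\<lambda>u v. \<phi> u v (s c a)) = (\<lambda>u v. c * \<phi> u v a)" for a a' c
    using assms(3) by (auto simp: trilin_form_def linear_iff fun_eq_iff)
  have eval: "d b (\<phi> (a + a')) = d b (\<phi> a) + d b (\<phi> a')"
    "d b (\<phi> (s c a)) = c * d b (\<phi> a)"
    "d b (\<lambda>u v. \<phi> u v (a + a')) = d b (\<lambda>u v. \<phi> u v a) + d b (\<lambda>u v. \<phi> u v a')"
    "d b (\<lambda>u v. \<phi> u v (s c a)) = c * d b (\<lambda>u v. \<phi> u v a)" for a a' b c
    unfolding expand
    by (rule tensor_eval_add[OF assms(2)] tensor_eval_scale[OF assms(2)];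
        rule trilin_form_bilin[OF assms(3)])+
  show "bilin s s (*) (\<lambda>a b. d b (\<phi> a))" "bilin s s (*) (\<lambda>a b. d a (\<lambda>u v. \<phi> u v b))"
    unfolding bilin_form_iff
    by (simp_all add: eval linear_add[OF assms(1)] linear_scale[OF assms(1)]
        linear_vector_spaces[OF assms(1)] fscale_def)
qed

lemma tensor_linear:
  assumes "vector_space sA" "vector_space sB"
  shows tensor_add_left: "tensor sA sB (a + a') b = tensor sA sB a b + tensor sA sB a' b"
    and tensor_add_right: "tensor sA sB a (b + b') = tensor sA sB a b + tensor sA sB a b'"
    and tensor_neg_left: "tensor sA sB (- a) b = - tensor sA sB a b"
    and tensor_neg_right: "tensor sA sB a (- b) = - tensor sA sB a b"
    and tensor_0_left: "tensor sA sB 0 b = 0"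
    and tensor_0_right: "tensor sA sB a 0 = 0"
    and tensor_scale_left: "tensor sA sB (sA c a) b = fscale c (tensor sA sB a b)"
    and tensor_scale_right: "tensor sA sB a (sB c b) = fscale c (tensor sA sB a b)"
proof -
  note l = bilin_fst[OF bilin_tensor[OF assms]] and r = bilin_snd[OF bilin_tensor[OF assms]]
  show "tensor sA sB (a + a') b = tensor sA sB a b + tensor sA sB a' b" by (rule linear_add[OF l])
  show "tensor sA sB a (b + b') = tensor sA sB a b + tensor sA sB a b'" by (rule linear_add[OF r])
  show "tensor sA sB (- a) b = - tensor sA sB a b" by (rule linear_neg[OF l])
  show "tensor sA sB a (- b) = - tensor sA sB a b" by (rule linear_neg[OF r])
  show "tensor sA sB 0 b = 0" by (rule linear_0[OF l])
  show "tensor sA sB a 0 = 0" by (rule linear_0[OF r])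
  show "tensor sA sB (sA c a) b = fscale c (tensor sA sB a b)" by (rule linear_scale[OF l])
  show "tensor sA sB a (sB c b) = fscale c (tensor sA sB a b)" by (rule linear_scale[OF r])
qed

section \<open>Homomorphisms of Lie bialgebras\<close>

lemma bilin_linear:
  "bilin sA sB sC h \<Longrightarrow> Vector_Spaces.linear sC sD f \<Longrightarrow> bilin sA sB sD (\<lambda>a b. f (h a b))"
  by (simp add: bilin_def linear_iff)

lemma linear_inv: "Vector_Spaces.linear s t f \<Longrightarrow> bij f \<Longrightarrow> Vector_Spaces.linear t s (inv f)"
  by (simp add: linear_iff) (metis bij_inv_eq_iff)

lemma lie_bialgebraD:
  assumes "lie_bialgebra s br d"
  shows "vector_space s" "bilin s s s br" "br a a = 0"
    "br a (br b c) + br b (br c a) + br c (br a b) = 0"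
    "Vector_Spaces.linear s fscale d" "d a \<in> tensor_space s s" "flip (d a) = - d a"
    "id_tensor s d (d a) - flip12 (id_tensor s d (d a)) = tensor_id s d (d a)"
    "d (br a b) = ad_tensor s br a (d b) - ad_tensor s br b (d a)"
  using assms by (auto simp: lie_bialgebra_def lie_algebra_def lie_coalgebra_def)
    (metis minus_equation_iff)

lemma lie_bracket_skew:
  assumes "lie_bialgebra s br d"
  shows "br a b = - br b a"
proof -
  have "br (a + b) (a + b) = (br a a + br b a) + (br a b + br b b)"
    by (simp only: linear_add[OF bilin_fst[OF lie_bialgebraD(2)[OF assms]]]
        linear_add[OF bilin_snd[OF lie_bialgebraD(2)[OF assms]]])
  then show ?thesis
    using lie_bialgebraD(3)[OF assms] by (simp add: eq_neg_iff_add_eq_0 add.commute)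
qed

text \<open>Applied to isomorphisms when a structure is transported, and to the inclusion
  \<open>iG\<close> for the \<gg> part of the compatibility axiom.\<close>

lemma ad_tensor_natural:
  assumes "Vector_Spaces.linear sA sB \<psi>" "bilin sA sA sA brA" "bilin sB sB sB brB"
    "\<And>b. \<psi> (brA a b) = brB (\<psi> a) (\<psi> b)"
  shows "tensor_map sB sB \<psi> \<psi> (ad_tensor sA brA a t)
    = ad_tensor sB brB (\<psi> a) (tensor_map sB sB \<psi> \<psi> t)"
proof -
  note [simp] = linear_id[OF linear_vector_spaces(1)[OF assms(1)]]
    linear_id[OF linear_vector_spaces(2)[OF assms(1)]] assms(1) bilin_snd[OF assms(2)] bilin_snd[OF assms(3)]
  show ?thesis
    by (simp add: ad_tensor_def tensor_map_add tensor_map_comp assms(4))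
qed

lemma ad_tensor_in:
  assumes "bilin s s s br" "t \<in> tensor_space s s"
  shows "ad_tensor s br a t \<in> tensor_space s s"
proof -
  note b = bilin_snd[OF assms(1)]
  note id = linear_id[OF linear_vector_spaces(1)[OF b]]
  show ?thesis
    unfolding ad_tensor_def by (intro tensor_space_add tensor_map_in[OF assms(2)] b id)
qed

lemma flip_ad_tensor: "flip (ad_tensor s br a t) = ad_tensor s br a (flip t)"
  by (simp only: ad_tensor_def flip_add flip_tensor_map add.commute)

lemma ad_tensor_add: "ad_tensor s br a (t + u) = ad_tensor s br a t + ad_tensor s br a u"
  and ad_tensor_diff: "ad_tensor s br a (t - u) = ad_tensor s br a t - ad_tensor s br a u"
  and ad_tensor_scale: "ad_tensor s br a (fscale c t) = fscale c (ad_tensor s br a t)"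
  and ad_tensor_neg: "ad_tensor s br a (- t) = - ad_tensor s br a t"
  by (simp_all only: ad_tensor_def tensor_map_add tensor_map_diff tensor_map_scale tensor_map_neg)
    (simp_all add: fscale_def fun_eq_iff algebra_simps)

lemma ad_tensor_add_left:
  assumes "bilin s s s br" "t \<in> tensor_space s s"
  shows "ad_tensor s br (a + b) t = ad_tensor s br a t + ad_tensor s br b t"
proof -
  note b = bilin_snd[OF assms(1)] and id = linear_id[OF linear_vector_spaces(1)[OF bilin_snd[OF assms(1)]]]
  have "br (a + b) = (\<lambda>c. br a c + br b c)"
    by (rule ext) (rule linear_add[OF bilin_fst[OF assms(1)]])
  then show ?thesis
    by (simp only: ad_tensor_def tensor_map_add_left[OF assms(2) b b id]
        tensor_map_add_right[OF assms(2) id b b] add_ac)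
qed

lemma ad_tensor_scale_left:
  assumes "bilin s s s br" "t \<in> tensor_space s s"
  shows "ad_tensor s br (s c a) t = fscale c (ad_tensor s br a t)"
proof -
  note b = bilin_snd[OF assms(1)] and id = linear_id[OF linear_vector_spaces(1)[OF bilin_snd[OF assms(1)]]]
  have "br (s c a) = (\<lambda>b. s c (br a b))"
    by (rule ext) (rule linear_scale[OF bilin_fst[OF assms(1)]])
  then show ?thesis
    by (simp only: ad_tensor_def tensor_map_scale_left[OF assms(2) b id]
        tensor_map_scale_right[OF assms(2) id b])
      (simp add: fscale_def fun_eq_iff algebra_simps)
qed

lemma ad_tensor_tensor:
  assumes "bilin s s s br"
  shows "ad_tensor s br a (tensor s s b c) = tensor s s (br a b) c + tensor s s b (br a c)"
  using assms linear_id[OF linear_vector_spaces(1)[OF bilin_snd[OF assms(1)]]]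
  by (simp add: ad_tensor_def tensor_map_tensor bilin_snd)

lemma lie_bialgebra_hom_comp:
  assumes "lie_bialgebra_hom sA brA dA sB brB dB \<psi>" "lie_bialgebra_hom sB brB dB sC brC dC \<chi>"
  shows "lie_bialgebra_hom sA brA dA sC brC dC (\<lambda>a. \<chi> (\<psi> a))"
proof -
  have "Vector_Spaces.linear sB sC \<chi>"
    using assms(2) by (simp add: lie_bialgebra_hom_def)
  then show ?thesis
    using assms linear_comp[of sA sB \<psi> sC \<chi>] by (simp add: lie_bialgebra_hom_def tensor_map_comp)
qed

lemma lie_bialgebra_hom_inv:
  assumes "lie_bialgebra sA brA dA" "lie_bialgebra_hom sA brA dA sB brB dB \<psi>" "bij \<psi>"
  shows "lie_bialgebra_hom sB brB dB sA brA dA (inv \<psi>)"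
proof -
  have lin: "Vector_Spaces.linear sA sB \<psi>"
    using assms(2) by (simp add: lie_bialgebra_hom_def)
  note linv = linear_inv[OF lin assms(3)]
  have inv: "inv \<psi> (\<psi> a) = a" "\<psi> (inv \<psi> u) = u" for a u
    using assms(3) by (simp_all add: bij_is_inj bij_is_surj surj_f_inv_f)
  show ?thesis
    unfolding lie_bialgebra_hom_def
  proof (intro conjI allI linv)
    fix u v
    have "brB u v = \<psi> (brA (inv \<psi> u) (inv \<psi> v))"
      using assms(2) by (simp add: lie_bialgebra_hom_def inv)
    then show "inv \<psi> (brB u v) = brA (inv \<psi> u) (inv \<psi> v)"
      by (simp add: inv)
    have "dB u = tensor_map sB sB \<psi> \<psi> (dA (inv \<psi> u))"
      using assms(2) by (metis lie_bialgebra_hom_def inv(2))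
    then have "tensor_map sA sA (inv \<psi>) (inv \<psi>) (dB u) = tensor_map sA sA id id (dA (inv \<psi> u))"
      by (simp add: tensor_map_comp[OF linv linv] inv id_def)
    then show "dA (inv \<psi> u) = tensor_map sA sA (inv \<psi>) (inv \<psi>) (dB u)"
      using lie_bialgebraD(6)[OF assms(1)] by (simp add: tensor_map_id)
  qed
qed

text \<open>Since \<psi> is bijective, the homomorphism equations determine \<open>brB\<close> and
  \<open>dB\<close> as the transported structure. Every element of the target is some \<psi> a, and
  an axiom at \<psi> a is the image of the axiom at a.\<close>

lemma lie_bialgebra_iso:
  assumes A: "lie_bialgebra sA brA dA" and hom: "lie_bialgebra_hom sA brA dA sB brB dB \<psi>"
    and "bij \<psi>"
  shows "lie_bialgebra sB brB dB"
proof -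
  have lin: "Vector_Spaces.linear sA sB \<psi>"
    and br: "brB (\<psi> a) (\<psi> b) = \<psi> (brA a b)"
    and d: "dB (\<psi> a) = tensor_map sB sB \<psi> \<psi> (dA a)" for a b
    using hom by (simp_all add: lie_bialgebra_hom_def)
  note linv = linear_inv[OF lin \<open>bij \<psi>\<close>]
  note AD = lie_bialgebraD[OF A]
  have inv: "\<psi> (inv \<psi> u) = u" for u
    using \<open>bij \<psi>\<close> by (simp add: bij_is_surj surj_f_inv_f)
  have br': "brB = (\<lambda>u v. \<psi> (brA (inv \<psi> u) (inv \<psi> v)))"
    by (simp add: inv flip: br)
  have d': "dB = (\<lambda>u. tensor_map sB sB \<psi> \<psi> (dA (inv \<psi> u)))"
    by (simp add: inv flip: d)
  have surj: "(\<And>a. P (\<psi> a)) \<Longrightarrow> P u" for P u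
    by (metis inv)
  have bil: "bilin sB sB sB brB"
    unfolding br' by (intro bilin_linear[OF _ lin] bilin_comp[OF _ linv linv] AD(2))
  have "lie_algebra sB brB"
    unfolding lie_algebra_def
  proof (intro conjI allI bil linear_vector_spaces(2)[OF lin])
    show "brB u u = 0" for u
      by (rule surj[of _ u]) (simp add: br AD linear_0[OF lin])
    show "brB u (brB v w) + brB v (brB w u) + brB w (brB u v) = 0" for u v w
      by (rule surj[of _ u], rule surj[of _ v], rule surj[of _ w])
        (simp add: br AD(4) linear_0[OF lin] flip: linear_add[OF lin])
  qed
  moreover have "lie_coalgebra sB dB"
    unfolding lie_coalgebra_def
  proof (intro conjI allI linear_vector_spaces(2)[OF lin])
    show lindB: "Vector_Spaces.linear sB fscale dB"
      by (simp add: d' linear_iff linear_vector_spaces[OF lin] vector_space_fscale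
          linear_add[OF linv] linear_scale[OF linv] linear_add[OF AD(5)] linear_scale[OF AD(5)]
          tensor_map_add tensor_map_scale)
    show dB_in: "dB u \<in> tensor_space sB sB" for u
      unfolding d' by (rule tensor_map_in[OF AD(6) lin lin])
    show "dB u = - flip (dB u)" for u
      by (rule surj[of _ u]) (simp add: d flip_tensor_map AD(7) tensor_map_neg)
    \<comment> \<open>A three-fold tensor of the target, evaluated on \<phi>, is the corresponding
      tensor of the source evaluated on the pull-back of \<phi> along \<psi>. Co-Jacobi follows by
      applying this to \<phi> and to \<phi> with its first two arguments exchanged, which is where
      \<open>flip12\<close> evaluates.\<close>
    have id: "id_tensor sB dB (dB (\<psi> a)) \<phi> = id_tensor sA dA (dA a) (\<lambda>u v w. \<phi> (\<psi> u) (\<psi> v) (\<psi> w))"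
      "tensor_id sB dB (dB (\<psi> a)) \<phi> = tensor_id sA dA (dA a) (\<lambda>u v w. \<phi> (\<psi> u) (\<psi> v) (\<psi> w))"
      if \<phi>: "trilin_form sB \<phi>" for \<phi> a
      using trilin_form_bilin[OF \<phi>] bilin_id_tensor[OF lindB dB_in \<phi>]
      by (simp_all add: id_tensor_def tensor_id_def \<phi> trilin_form_comp[OF \<phi> lin lin lin] d tensor_map_def)
    have cojacobi: "(id_tensor sB dB (dB (\<psi> a)) - flip12 (id_tensor sB dB (dB (\<psi> a)))) \<phi> = tensor_id sB dB (dB (\<psi> a)) \<phi>" for a \<phi>
    proof (cases "trilin_form sB \<phi>")
      case True
      have "tensor_id sA dA (dA a) (\<lambda>u v w. \<phi> (\<psi> u) (\<psi> v) (\<psi> w)) =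
        (id_tensor sA dA (dA a) - flip12 (id_tensor sA dA (dA a))) (\<lambda>u v w. \<phi> (\<psi> u) (\<psi> v) (\<psi> w))"
        by (simp only: AD(8))
      then show ?thesis
        using id[OF True] id(1)[OF trilin_form_swap[THEN iffD2, OF True]]
        by (simp add: flip12_def)
    next
      case False
      then show ?thesis
        using trilin_form_swap[of sB \<phi>] by (simp add: flip12_def id_tensor_def tensor_id_def)
    qed
    show "id_tensor sB dB (dB u) - flip12 (id_tensor sB dB (dB u)) = tensor_id sB dB (dB u)" for u
      by (rule surj[of _ u], rule ext, rule cojacobi)
  qed
  moreover have "dB (brB u v) = ad_tensor sB brB u (dB v) - ad_tensor sB brB v (dB u)" for u v
  proof -
    have natural: "tensor_map sB sB \<psi> \<psi> (ad_tensor sA brA a t) = ad_tensor sB brB (\<psi> a) (tensor_map sB sB \<psi> \<psi> t)" for a t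
      by (rule ad_tensor_natural[OF lin AD(2) bil]) (simp only: br)
    have "dB (brB (\<psi> a) (\<psi> b)) = ad_tensor sB brB (\<psi> a) (dB (\<psi> b)) - ad_tensor sB brB (\<psi> b) (dB (\<psi> a))" for a b
      by (simp only: br d AD(9) tensor_map_diff natural)
    from this[of "inv \<psi> u" "inv \<psi> v"] show ?thesis
      by (simp only: inv)
  qed
  ultimately show ?thesis
    by (simp add: lie_bialgebra_def)
qed

section \<open>Lie bialgebra structures on a direct sum\<close>

locale lie_bialgebra_sum =
  fixes sG :: "'k::field \<Rightarrow> 'g::ab_group_add \<Rightarrow> 'g"
    and brG :: "'g \<Rightarrow> 'g \<Rightarrow> 'g"
    and dG :: "'g \<Rightarrow> ('k, 'g, 'g) tensor2"
    and sV :: "'k \<Rightarrow> 'v::ab_group_add \<Rightarrow> 'v"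
  assumes lie_bialgebra_G: "lie_bialgebra sG brG dG"
    and vector_space_V: "vector_space sV"
begin

abbreviation s :: "'k \<Rightarrow> 'g \<times> 'v \<Rightarrow> 'g \<times> 'v"
  where "s \<equiv> sum_scale sG sV"

abbreviation iG :: "'g \<Rightarrow> 'g \<times> 'v"
  where "iG \<equiv> (\<lambda>a. (a, 0))"

abbreviation iV :: "'v \<Rightarrow> 'g \<times> 'v"
  where "iV \<equiv> (\<lambda>x. (0, x))"

abbreviation br :: "('k, 'g, 'v) ext_system \<Rightarrow> 'g \<times> 'v \<Rightarrow> 'g \<times> 'v \<Rightarrow> 'g \<times> 'v"
  where "br \<equiv> sum_bracket brG"

abbreviation d :: "('k, 'g, 'v) ext_system \<Rightarrow> 'g \<times> 'v \<Rightarrow> ('k, 'g \<times> 'v, 'g \<times> 'v) tensor2"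
  where "d \<equiv> sum_cobracket sG dG sV"

lemmas G = lie_bialgebraD[OF lie_bialgebra_G]

lemma vector_space_s: "vector_space s"
proof -
  interpret vector_space_prod sG sV
    by (simp add: vector_space_prod_def vector_space_pair_def G(1) vector_space_V)
  show ?thesis by (rule p.vector_space_axioms)
qed

lemma s_apply: "s c u = (sG c (fst u), sV c (snd u))"
proof -
  interpret vector_space_prod sG sV
    by (simp add: vector_space_prod_def vector_space_pair_def G(1) vector_space_V)
  show ?thesis by (rule scale_def)
qed

lemma linear_components:
  shows linear_fst: "Vector_Spaces.linear s sG fst"
    and linear_snd: "Vector_Spaces.linear s sV snd"
    and linear_iG: "Vector_Spaces.linear sG s iG"
    and linear_iV: "Vector_Spaces.linear sV s iV"
  by (simp_all add: linear_iff vector_space_s vector_space_V G(1) s_apply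
      module.scale_zero_right[OF vector_space_module])

lemmas injection_in =
    tensor_map_in[OF _ linear_iG linear_iG] tensor_map_in[OF _ linear_iG linear_iV]
    tensor_map_in[OF _ linear_iV linear_iV]
  and projection_in =
    tensor_map_in[OF _ linear_fst linear_fst] tensor_map_in[OF _ linear_fst linear_snd]
    tensor_map_in[OF _ linear_snd linear_snd]

text \<open>Splitting both arguments of the form into their \<gg> and V parts turns the evaluation
  into four summands. Skew-symmetry rewrites the one on V and \<gg>, which leaves the shape of
  \<open>sum_cobracket\<close>.\<close>

lemma skew_tensor_decomp:
  assumes "t \<in> tensor_space s s" "flip t = - t"
  shows "t = tensor_map s s iG iG (tensor_map sG sG fst fst t)
    + tensor_map s s iG iV (tensor_map sG sV fst snd t)
    - flip (tensor_map s s iG iV (tensor_map sG sV fst snd t))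
    + tensor_map s s iV iV (tensor_map sV sV snd snd t)" (is "t = ?u")
proof (rule tensor_space_eqI[OF assms(1)])
  show "?u \<in> tensor_space s s"
    by (intro tensor_space_add tensor_space_diff flip_in injection_in projection_in assms(1))
  fix \<phi> assume \<phi>: "bilin s s (*) \<phi>"
  note lc = linear_comp[OF linear_fst linear_iG] linear_comp[OF linear_snd linear_iV]
  note b = bilin_comp[OF \<phi> lc(1) lc(1)] bilin_comp[OF \<phi> lc(1) lc(2)]
    bilin_comp[OF \<phi> lc(2) lc(1)] bilin_comp[OF \<phi> lc(2) lc(2)]
  have split: "\<phi> u v = \<phi> (iG (fst u)) (iG (fst v)) + (\<phi> (iG (fst u)) (iV (snd v))
    + (\<phi> (iV (snd u)) (iG (fst v)) + \<phi> (iV (snd u)) (iV (snd v))))" for u v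
  proof -
    have "\<phi> (iG (fst u) + iV (snd u)) (iG (fst v) + iV (snd v)) = \<phi> (iG (fst u)) (iG (fst v))
      + (\<phi> (iG (fst u)) (iV (snd v)) + (\<phi> (iV (snd u)) (iG (fst v)) + \<phi> (iV (snd u)) (iV (snd v))))"
      by (simp only: linear_add[OF bilin_fst[OF \<phi>]] linear_add[OF bilin_snd[OF \<phi>]] ac_simps)
    then show ?thesis
      by simp
  qed
  have skew: "t (\<lambda>u v. \<phi> (iV (snd u)) (iG (fst v))) = - t (\<lambda>v u. \<phi> (iV (snd u)) (iG (fst v)))"
    using fun_cong[OF assms(2), of "\<lambda>v u. \<phi> (iV (snd u)) (iG (fst v))"]
    by (simp add: flip_def)
  have "t \<phi> = t (\<lambda>u v. \<phi> (iG (fst u)) (iG (fst v)) + (\<phi> (iG (fst u)) (iV (snd v))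
    + (\<phi> (iV (snd u)) (iG (fst v)) + \<phi> (iV (snd u)) (iV (snd v)))))"
    by (rule arg_cong[of _ _ t]) (intro ext split)
  also have "\<dots> = t (\<lambda>u v. \<phi> (iG (fst u)) (iG (fst v))) + (t (\<lambda>u v. \<phi> (iG (fst u)) (iV (snd v)))
    + (t (\<lambda>u v. \<phi> (iV (snd u)) (iG (fst v))) + t (\<lambda>u v. \<phi> (iV (snd u)) (iV (snd v)))))"
    by (simp only: tensor_eval_add[OF assms(1)] bilin_form_add b)
  also have "\<dots> = ?u \<phi>"
    unfolding skew
    by (simp add: tensor_map_comp linear_components)
      (simp add: tensor_map_def flip_def \<phi> bilin_swap[of s s "(*)" \<phi>])
  finally show "t \<phi> = ?u \<phi>" .
qed

text \<open>This is the test by which cobracket identities in the sum are reduced to identities over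
  \<gg> and V.\<close>

lemma skew_tensor_eqI:
  assumes "t \<in> tensor_space s s" "flip t = - t" "u \<in> tensor_space s s" "flip u = - u"
    "tensor_map sG sG fst fst t = tensor_map sG sG fst fst u"
    "tensor_map sG sV fst snd t = tensor_map sG sV fst snd u"
    "tensor_map sV sV snd snd t = tensor_map sV sV snd snd u"
  shows "t = u"
  using skew_tensor_decomp[OF assms(1,2)] skew_tensor_decomp[OF assms(3,4)]
  by (simp only: assms(5-7))

text \<open>A pair of projections kills every summand except those whose injections match it. The
  \<open>snd\<close>, \<open>fst\<close> component comes from the flipped summand and inherits its
  sign.\<close>

lemma
  assumes "DelE \<Omega> x \<in> tensor_space sG sV" "DelV \<Omega> x \<in> tensor_space sG sG"
    "delV \<Omega> x \<in> tensor_space sV sV"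
  shows d_in: "d \<Omega> (a, x) \<in> tensor_space s s"
    and d_fst_fst: "tensor_map sG sG fst fst (d \<Omega> (a, x)) = dG a + DelV \<Omega> x"
    and d_fst_snd: "tensor_map sG sV fst snd (d \<Omega> (a, x)) = DelE \<Omega> x"
    and d_snd_fst: "tensor_map sV sG snd fst (d \<Omega> (a, x)) = - flip (DelE \<Omega> x)"
    and d_snd_snd: "tensor_map sV sV snd snd (d \<Omega> (a, x)) = delV \<Omega> x"
proof -
  note mem = assms G(6)
  show "d \<Omega> (a, x) \<in> tensor_space s s"
    by (simp add: Let_def)
      (intro tensor_space_add tensor_space_diff flip_in injection_in mem)
  note maps = Let_def tensor_map_add tensor_map_diff flip_tensor_map tensor_map_comp linear_components
    mem[THEN flip_in, THEN tensor_map_zero(1)] mem[THEN flip_in, THEN tensor_map_zero(2)]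
    mem[THEN tensor_map_zero(1)] mem[THEN tensor_map_zero(2)]
    mem[THEN flip_in, THEN tensor_map_id, unfolded id_def] mem[THEN tensor_map_id, unfolded id_def]
  show "tensor_map sG sG fst fst (d \<Omega> (a, x)) = dG a + DelV \<Omega> x"
    "tensor_map sG sV fst snd (d \<Omega> (a, x)) = DelE \<Omega> x"
    "tensor_map sV sG snd fst (d \<Omega> (a, x)) = - flip (DelE \<Omega> x)"
    "tensor_map sV sV snd snd (d \<Omega> (a, x)) = delV \<Omega> x"
    by (simp_all add: maps)
qed

lemma LBI_D:
  assumes "\<Omega> \<in> LBI sG brG dG sV"
  shows "bilin sV sG sV (ract \<Omega>)" "bilin sV sG sG (lact \<Omega>)"
    "bilin sV sV sG (cocyc \<Omega>)" "bilin sV sV sV (brV \<Omega>)"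
    "Vector_Spaces.linear sV fscale (DelE \<Omega>)" "DelE \<Omega> x \<in> tensor_space sG sV"
    "Vector_Spaces.linear sV fscale (DelV \<Omega>)" "DelV \<Omega> x \<in> tensor_space sG sG"
    "Vector_Spaces.linear sV fscale (delV \<Omega>)" "delV \<Omega> x \<in> tensor_space sV sV"
    "lie_bialgebra s (br \<Omega>) (d \<Omega>)"
  using assms by (simp_all add: LBI_def)

section \<open>Shears, the linear maps of the sum that fix \<gg> pointwise\<close>

definition shear :: "('v \<Rightarrow> 'g) \<Rightarrow> ('v \<Rightarrow> 'v) \<Rightarrow> 'g \<times> 'v \<Rightarrow> 'g \<times> 'v"
  where "shear p q u = (fst u + p (snd u), q (snd u))"

lemma linear_shear:
  assumes "Vector_Spaces.linear sV sG p" "Vector_Spaces.linear sV sV q"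
  shows "Vector_Spaces.linear s s (shear p q)"
  using assms vector_space_s
  by (simp add: linear_iff shear_def s_apply algebra_simps
      module.scale_right_distrib[OF vector_space_module])

lemma bij_shear_iff:
  assumes "Vector_Spaces.linear sV sG p" "Vector_Spaces.linear sV sV q"
  shows "bij (shear p q) \<longleftrightarrow> bij q"
proof
  assume "bij (shear p q)"
  show "bij q"
  proof (rule bijI)
    show "inj q"
    proof (rule injI)
      fix x y assume "q x = q y"
      \<comment> \<open>The first entries are exchanged so that both images have first component p x
        + p y.\<close>
      then have "shear p q (p y, x) = shear p q (p x, y)"
        by (simp add: shear_def add.commute)
      from injD[OF bij_is_inj[OF \<open>bij (shear p q)\<close>] this] show "x = y"
        by simp
    qed
    show "surj q"
    proof (rule surjI)
      fix y
      have "shear p q (inv (shear p q) (0, y)) = (0, y)"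
        by (rule surj_f_inv_f[OF bij_is_surj[OF \<open>bij (shear p q)\<close>]])
      then show "q (snd (inv (shear p q) (0, y))) = y"
        by (simp add: shear_def)
    qed
  qed
next
  assume "bij q"
  show "bij (shear p q)"
  proof (rule bijI)
    show "inj (shear p q)"
    proof (rule injI)
      fix u v assume eq: "shear p q u = shear p q v"
      then have "snd u = snd v"
        using injD[OF bij_is_inj[OF \<open>bij q\<close>]] by (simp add: shear_def)
      with eq show "u = v"
        by (simp add: shear_def prod_eq_iff)
    qed
    show "surj (shear p q)"
    proof (rule surjI)
      fix u
      show "shear p q (fst u - p (inv q (snd u)), inv q (snd u)) = u"
        using \<open>bij q\<close> by (simp add: shear_def bij_is_surj surj_f_inv_f)
    qed
  qed
qed

lemma linear_fixing_iG_eq_shear: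
  assumes "Vector_Spaces.linear s s \<phi>" "\<And>a. \<phi> (iG a) = iG a"
  obtains p q where "Vector_Spaces.linear sV sG p" "Vector_Spaces.linear sV sV q" "\<phi> = shear p q"
proof
  show "Vector_Spaces.linear sV sG (\<lambda>x. fst (\<phi> (iV x)))" "Vector_Spaces.linear sV sV (\<lambda>x. snd (\<phi> (iV x)))"
    by (intro linear_comp[OF linear_iV] linear_comp[OF assms(1)] linear_fst linear_snd)+
  show "\<phi> = shear (\<lambda>x. fst (\<phi> (iV x))) (\<lambda>x. snd (\<phi> (iV x)))"
  proof
    fix u
    have "\<phi> (iG (fst u) + iV (snd u)) = iG (fst u) + \<phi> (iV (snd u))"
      by (simp only: linear_add[OF assms(1)] assms(2))
    then show "\<phi> u = shear (\<lambda>x. fst (\<phi> (iV x))) (\<lambda>x. snd (\<phi> (iV x))) u"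
      by (simp add: shear_def prod_eq_iff)
  qed
qed

text \<open>Stated at q x, so that no inverse of q occurs; the inverse enters in
  \<open>LBI_equiv_iff\<close>. The terms with p arise because \<open>fst\<close> after the shear is
  \<open>fst\<close> plus p after \<open>snd\<close>, and \<open>tensor_map\<close> is additive in
  each leg.\<close>

lemma shear_cobracket_iff:
  assumes \<Omega>: "\<Omega> \<in> LBI sG brG dG sV" and \<Omega>': "\<Omega>' \<in> LBI sG brG dG sV"
    and p: "Vector_Spaces.linear sV sG p" and q: "Vector_Spaces.linear sV sV q"
  shows "d \<Omega>' (shear p q (a, x)) = tensor_map s s (shear p q) (shear p q) (d \<Omega> (a, x)) \<longleftrightarrow>
    delV \<Omega>' (q x) = tensor_map sV sV q q (delV \<Omega> x) \<and>
    DelE \<Omega>' (q x) = tensor_map sG sV id q (DelE \<Omega> x) + tensor_map sG sV p q (delV \<Omega> x) \<and>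
    DelV \<Omega>' (q x) = tensor_map sG sG id p (DelE \<Omega> x) - tensor_map sG sG p id (flip (DelE \<Omega> x))
      + tensor_map sG sG p p (delV \<Omega> x) + DelV \<Omega> x - dG (p x)"
    (is "?t = ?u \<longleftrightarrow> ?R")
proof -
  note D = LBI_D[OF \<Omega>] and D' = LBI_D[OF \<Omega>']
  note proj = d_fst_fst[of \<Omega> x a, OF D(6,8,10)] d_fst_snd[of \<Omega> x a, OF D(6,8,10)]
    d_snd_fst[of \<Omega> x a, OF D(6,8,10)] d_snd_snd[of \<Omega> x a, OF D(6,8,10)]
  note sh = linear_shear[OF p q]
  note din = d_in[of \<Omega> x a, OF D(6,8,10)]
  note psnd = linear_comp[OF linear_snd p] and qsnd = linear_comp[OF linear_snd q]
    and fstp = vector_space_pair.linear_compose_add[OF _ linear_fst linear_comp[OF linear_snd p]]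
  have vp: "vector_space_pair s sG"
    by (simp add: vector_space_pair_def vector_space_s G(1))
  have idG: "Vector_Spaces.linear sG sG id"
    by (rule linear_id) (rule G(1))
  \<comment> \<open>Each summand factors through one component of the cobracket of \<Omega>, which
    \<open>proj\<close> then evaluates. The summand p \<otimes> id passes through the V \<otimes>
    \<gg> component, hence the minus sign and the flip in the claim.\<close>
  have split: "tensor_map sG sG (\<lambda>u. fst u) (\<lambda>u. p (snd u)) t = tensor_map sG sG id p (tensor_map sG sV fst snd t)"
    "tensor_map sG sG (\<lambda>u. p (snd u)) (\<lambda>u. fst u) t = tensor_map sG sG p id (tensor_map sV sG snd fst t)"
    "tensor_map sG sG (\<lambda>u. p (snd u)) (\<lambda>u. p (snd u)) t = tensor_map sG sG p p (tensor_map sV sV snd snd t)"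
    "tensor_map sG sV (\<lambda>u. fst u) (\<lambda>u. q (snd u)) t = tensor_map sG sV id q (tensor_map sG sV fst snd t)"
    "tensor_map sG sV (\<lambda>u. p (snd u)) (\<lambda>u. q (snd u)) t = tensor_map sG sV p q (tensor_map sV sV snd snd t)"
    "tensor_map sV sV (\<lambda>u. q (snd u)) (\<lambda>u. q (snd u)) t = tensor_map sV sV q q (tensor_map sV sV snd snd t)"
    for t
    by (simp_all add: tensor_map_comp p q idG)
  have mem: "?t \<in> tensor_space s s" "?u \<in> tensor_space s s" "flip ?t = - ?t" "flip ?u = - ?u"
    using lie_bialgebraD(6,7)[OF D(11)] lie_bialgebraD(6,7)[OF D'(11)]
    by (simp_all add: flip_tensor_map tensor_map_in[OF _ sh sh] tensor_map_neg
        del: sum_cobracket.simps)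
  have t: "tensor_map sG sG fst fst ?t = dG a + dG (p x) + DelV \<Omega>' (q x)"
    "tensor_map sG sV fst snd ?t = DelE \<Omega>' (q x)" "tensor_map sV sV snd snd ?t = delV \<Omega>' (q x)"
    unfolding shear_def fst_conv snd_conv
    by (simp_all only: d_fst_fst d_fst_snd d_snd_snd D' linear_add[OF G(5)])
  have u: "tensor_map sG sG fst fst ?u = dG a + DelV \<Omega> x + tensor_map sG sG id p (DelE \<Omega> x)
      - tensor_map sG sG p id (flip (DelE \<Omega> x)) + tensor_map sG sG p p (delV \<Omega> x)"
    "tensor_map sG sV fst snd ?u = tensor_map sG sV id q (DelE \<Omega> x) + tensor_map sG sV p q (delV \<Omega> x)"
    "tensor_map sV sV snd snd ?u = tensor_map sV sV q q (delV \<Omega> x)"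
    unfolding tensor_map_comp[OF linear_fst linear_fst] tensor_map_comp[OF linear_fst linear_snd]
      tensor_map_comp[OF linear_snd linear_snd] shear_def fst_conv snd_conv
    by (simp_all only: tensor_map_add_left[OF din linear_fst psnd fstp[OF vp]]
        tensor_map_add_right[OF din linear_fst linear_fst psnd] tensor_map_add_right[OF din psnd linear_fst psnd]
        tensor_map_add_left[OF din linear_fst psnd qsnd] split proj tensor_map_neg add_ac diff_conv_add_uminus)
  have "?t = ?u \<longleftrightarrow> tensor_map sG sG fst fst ?t = tensor_map sG sG fst fst ?u \<and>
    tensor_map sG sV fst snd ?t = tensor_map sG sV fst snd ?u \<and>
    tensor_map sV sV snd snd ?t = tensor_map sV sV snd snd ?u"
    using skew_tensor_eqI[OF mem(1,3,2,4)] by metis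
  also have "\<dots> \<longleftrightarrow> ?R"
    unfolding t u by (auto simp: algebra_simps simp del: plus_fun_apply)
  finally show ?thesis .
qed

lemma shear_bracket_iff:
  assumes \<Omega>: "\<Omega> \<in> LBI sG brG dG sV" and \<Omega>': "\<Omega>' \<in> LBI sG brG dG sV"
    and p: "Vector_Spaces.linear sV sG p" and q: "Vector_Spaces.linear sV sV q"
  shows "(\<forall>u v. shear p q (br \<Omega> u v) = br \<Omega>' (shear p q u) (shear p q v)) \<longleftrightarrow>
    (\<forall>a x y.
      ract \<Omega>' (q x) a = q (ract \<Omega> x a) \<and>
      lact \<Omega>' (q x) a = p (ract \<Omega> x a) + lact \<Omega> x a - brG (p x) a \<and>
      cocyc \<Omega>' (q x) (q y) = cocyc \<Omega> x y + p (brV \<Omega> x y) + brG (p x) (p y)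
        - p (ract \<Omega> x (p y)) - lact \<Omega> x (p y) + p (ract \<Omega> y (p x)) + lact \<Omega> y (p x) \<and>
      brV \<Omega>' (q x) (q y) = q (brV \<Omega> x y) - q (ract \<Omega> x (p y)) + q (ract \<Omega> y (p x)))"
    (is "?L \<longleftrightarrow> ?R")
proof -
  note D = LBI_D[OF \<Omega>] and D' = LBI_D[OF \<Omega>']
  note lin = linear_add[OF p] linear_add[OF q] linear_diff[OF p] linear_diff[OF q] linear_0[OF p] linear_0[OF q]
    linear_add[OF bilin_fst[OF G(2)]] linear_add[OF bilin_snd[OF G(2)]]
    linear_0[OF bilin_fst[OF G(2)]] linear_0[OF bilin_snd[OF G(2)]]
    linear_0[OF bilin_fst[OF D(1)]] linear_0[OF bilin_snd[OF D(1)]]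
    linear_0[OF bilin_fst[OF D(2)]] linear_0[OF bilin_snd[OF D(2)]]
    linear_0[OF bilin_fst[OF D(3)]] linear_0[OF bilin_snd[OF D(3)]]
    linear_0[OF bilin_fst[OF D(4)]] linear_0[OF bilin_snd[OF D(4)]]
    linear_0[OF bilin_fst[OF D'(1)]] linear_0[OF bilin_snd[OF D'(1)]]
    linear_0[OF bilin_fst[OF D'(2)]] linear_0[OF bilin_snd[OF D'(2)]]
    linear_0[OF bilin_fst[OF D'(3)]] linear_0[OF bilin_snd[OF D'(3)]]
    linear_0[OF bilin_fst[OF D'(4)]] linear_0[OF bilin_snd[OF D'(4)]]
    linear_add[OF bilin_snd[OF D'(1)]] linear_add[OF bilin_snd[OF D'(2)]]
  note skew = lie_bracket_skew[OF lie_bialgebra_G]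
  show ?thesis
  proof
    assume L: ?L
    have 1: "lact \<Omega>' (q x) a = p (ract \<Omega> x a) + lact \<Omega> x a - brG (p x) a"
      "ract \<Omega>' (q x) a = q (ract \<Omega> x a)" for a x
      using L[rule_format, of "(0, x)" "(a, 0)"]
      by (auto simp: shear_def lin algebra_simps)
    \<comment> \<open>Solving for the new cocycle leaves -[p x, p y] and the new actions at p x and
      p y. Each of the two left actions contributes one [p x, p y] when \<open>1\<close> is
      inserted, and this produces the plus sign of the claim.\<close>
    have 2: "cocyc \<Omega>' (q x) (q y) = cocyc \<Omega> x y + p (brV \<Omega> x y) - brG (p x) (p y)
        - lact \<Omega>' (q x) (p y) + lact \<Omega>' (q y) (p x)"
      "brV \<Omega>' (q x) (q y) = q (brV \<Omega> x y) - ract \<Omega>' (q x) (p y) + ract \<Omega>' (q y) (p x)" for x y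
      using L[rule_format, of "(0, x)" "(0, y)"]
      by (auto simp: shear_def lin algebra_simps)
    show ?R
    proof (intro allI conjI)
      fix a x y
      show "cocyc \<Omega>' (q x) (q y) = cocyc \<Omega> x y + p (brV \<Omega> x y) + brG (p x) (p y)
        - p (ract \<Omega> x (p y)) - lact \<Omega> x (p y) + p (ract \<Omega> y (p x)) + lact \<Omega> y (p x)"
        unfolding 2 1 using skew[of "p y" "p x"] by (simp add: algebra_simps)
    qed (simp_all add: 1 2)
  next
    assume R: ?R
    show ?L
    proof (intro allI)
      fix u v :: "'g \<times> 'v"
      obtain a x b y where uv: "u = (a, x)" "v = (b, y)"
        by (cases u, cases v)
      show "shear p q (br \<Omega> u v) = br \<Omega>' (shear p q u) (shear p q v)"
        using skew[of a "p y"] skew[of "p y" "p x"]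
        by (simp add: uv shear_def lin R algebra_simps)
    qed
  qed
qed

lemma LBI_equiv_iff:
  "(\<Omega>, \<Omega>') \<in> LBI_equiv sG brG dG sV \<longleftrightarrow> \<Omega> \<in> LBI sG brG dG sV \<and> \<Omega>' \<in> LBI sG brG dG sV \<and>
    (\<exists>\<phi>. lie_bialgebra_hom s (br \<Omega>) (d \<Omega>) s (br \<Omega>') (d \<Omega>') \<phi> \<and> bij \<phi> \<and> (\<forall>a. \<phi> (iG a) = iG a))"
proof (cases "\<Omega> \<in> LBI sG brG dG sV \<and> \<Omega>' \<in> LBI sG brG dG sV")
  case True
  then have \<Omega>: "\<Omega> \<in> LBI sG brG dG sV" and \<Omega>': "\<Omega>' \<in> LBI sG brG dG sV"
    by simp_all
  \<comment> \<open>The preimages are separate arguments, so that the same formula serves at x with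
    \<open>inv q x\<close> and, after replacing x by q x, at q x with x itself. As q is bijective
    the two versions are equivalent.\<close>
  let ?C = "\<lambda>p q a x y x' y'.
    delV \<Omega>' x = tensor_map sV sV q q (delV \<Omega> x') \<and>
    DelE \<Omega>' x = tensor_map sG sV id q (DelE \<Omega> x') + tensor_map sG sV p q (delV \<Omega> x') \<and>
    DelV \<Omega>' x = tensor_map sG sG id p (DelE \<Omega> x') - tensor_map sG sG p id (flip (DelE \<Omega> x'))
      + tensor_map sG sG p p (delV \<Omega> x') + DelV \<Omega> x' - dG (p x') \<and>
    ract \<Omega>' x a = q (ract \<Omega> x' a) \<and>
    lact \<Omega>' x a = p (ract \<Omega> x' a) + lact \<Omega> x' a - brG (p x') a \<and>
    cocyc \<Omega>' x y = cocyc \<Omega> x' y' + p (brV \<Omega> x' y') + brG (p x') (p y')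
      - p (ract \<Omega> x' (p y')) - lact \<Omega> x' (p y') + p (ract \<Omega> y' (p x')) + lact \<Omega> y' (p x') \<and>
    brV \<Omega>' x y = q (brV \<Omega> x' y') - q (ract \<Omega> x' (p y')) + q (ract \<Omega> y' (p x'))"
  have hom_iff: "lie_bialgebra_hom s (br \<Omega>) (d \<Omega>) s (br \<Omega>') (d \<Omega>') (shear p q) \<longleftrightarrow>
    (\<forall>a x y. ?C p q a x y (inv q x) (inv q y))"
    if p: "Vector_Spaces.linear sV sG p" and q: "Vector_Spaces.linear sV sV q" and "bij q" for p q
  proof -
    have inv: "inv q (q x) = x" "q (inv q x) = x" for x
      using \<open>bij q\<close> by (simp_all add: bij_is_inj bij_is_surj surj_f_inv_f)
    have "(\<forall>a x y. ?C p q a x y (inv q x) (inv q y)) \<longleftrightarrow> (\<forall>a x y. ?C p q a (q x) (q y) x y)"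
      by (metis inv)
    also have "\<dots> \<longleftrightarrow> (\<forall>u v. shear p q (br \<Omega> u v) = br \<Omega>' (shear p q u) (shear p q v)) \<and>
        (\<forall>a x. d \<Omega>' (shear p q (a, x)) = tensor_map s s (shear p q) (shear p q) (d \<Omega> (a, x)))"
      unfolding shear_bracket_iff[OF \<Omega> \<Omega>' p q] shear_cobracket_iff[OF \<Omega> \<Omega>' p q] by blast
    finally show ?thesis
      unfolding lie_bialgebra_hom_def using linear_shear[OF p q] by (simp add: split_paired_all)
  qed
  show ?thesis
  proof
    assume "(\<Omega>, \<Omega>') \<in> LBI_equiv sG brG dG sV"
    then obtain p q where pq: "Vector_Spaces.linear sV sG p" "Vector_Spaces.linear sV sV q" "bij q"
      and C: "\<forall>a x y. ?C p q a x y (inv q x) (inv q y)"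
      unfolding LBI_equiv_def Let_def by blast
    show "\<Omega> \<in> LBI sG brG dG sV \<and> \<Omega>' \<in> LBI sG brG dG sV \<and>
      (\<exists>\<phi>. lie_bialgebra_hom s (br \<Omega>) (d \<Omega>) s (br \<Omega>') (d \<Omega>') \<phi> \<and> bij \<phi> \<and> (\<forall>a. \<phi> (iG a) = iG a))"
    proof (intro conjI exI[of _ "shear p q"] \<Omega> \<Omega>' allI)
      show "lie_bialgebra_hom s (br \<Omega>) (d \<Omega>) s (br \<Omega>') (d \<Omega>') (shear p q)"
        using C hom_iff[OF pq] by blast
      show "bij (shear p q)"
        using bij_shear_iff[OF pq(1,2)] pq(3) by blast
      show "shear p q (iG a) = iG a" for a
        by (simp add: shear_def linear_0[OF pq(1)] linear_0[OF pq(2)])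
    qed
  next
    assume "\<Omega> \<in> LBI sG brG dG sV \<and> \<Omega>' \<in> LBI sG brG dG sV \<and>
      (\<exists>\<phi>. lie_bialgebra_hom s (br \<Omega>) (d \<Omega>) s (br \<Omega>') (d \<Omega>') \<phi> \<and> bij \<phi> \<and> (\<forall>a. \<phi> (iG a) = iG a))"
    then obtain \<phi> where \<phi>: "lie_bialgebra_hom s (br \<Omega>) (d \<Omega>) s (br \<Omega>') (d \<Omega>') \<phi>" "bij \<phi>"
      "\<And>a. \<phi> (iG a) = iG a"
      by blast
    have "Vector_Spaces.linear s s \<phi>"
      using \<phi>(1) unfolding lie_bialgebra_hom_def by blast
    then obtain p q where pq: "Vector_Spaces.linear sV sG p" "Vector_Spaces.linear sV sV q"
      and eq: "\<phi> = shear p q"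
      using linear_fixing_iG_eq_shear[OF _ \<phi>(3)] by blast
    have "bij q"
      using bij_shear_iff[OF pq] \<phi>(2) eq by blast
    then have "\<forall>a x y. ?C p q a x y (inv q x) (inv q y)"
      using hom_iff[OF pq] \<phi>(1) eq by blast
    then show "(\<Omega>, \<Omega>') \<in> LBI_equiv sG brG dG sV"
      unfolding LBI_equiv_def Let_def using \<Omega> \<Omega>' pq \<open>bij q\<close> by blast
  qed
next
  case False
  then show ?thesis
    by (auto simp: LBI_equiv_def)
qed

section \<open>Extending systems and the structures on E containing \<gg>\<close>

lemma lie_bialgebra_hom_iG:
  assumes "\<Omega> \<in> LBI sG brG dG sV"
  shows "lie_bialgebra_hom sG brG dG s (br \<Omega>) (d \<Omega>) iG"
proof -
  note D = LBI_D[OF assms]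
  show ?thesis
    by (simp add: lie_bialgebra_hom_def linear_iG Let_def tensor_map_0 flip_0
      linear_0[OF bilin_fst[OF D(1)]] linear_0[OF bilin_fst[OF D(2)]] linear_0[OF bilin_fst[OF D(3)]]
      linear_0[OF bilin_fst[OF D(4)]] linear_0[OF D(5)] linear_0[OF D(7)] linear_0[OF D(9)]
      del: zero_fun_apply)
qed

text \<open>Provides surjectivity of the map from systems to structures. The system is read off on
  V; the \<gg> part is forced by the homomorphism \<open>iG\<close>, and the values of the bracket
  on \<gg> and V in the other order are forced by skew-symmetry.\<close>

lemma LBI_exhaust:
  assumes B: "lie_bialgebra s br0 d0" and hom: "lie_bialgebra_hom sG brG dG s br0 d0 iG"
  obtains \<Omega> where "\<Omega> \<in> LBI sG brG dG sV" "br \<Omega> = br0" "d \<Omega> = d0"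
proof
  note BD = lie_bialgebraD[OF B]
  have homD: "br0 (iG a) (iG b) = iG (brG a b)" "d0 (iG a) = tensor_map s s iG iG (dG a)" for a b
    using hom by (simp_all add: lie_bialgebra_hom_def)
  let ?\<Omega> = "\<lparr>ract = (\<lambda>x b. snd (br0 (iV x) (iG b))), lact = (\<lambda>x b. fst (br0 (iV x) (iG b))),
    cocyc = (\<lambda>x y. fst (br0 (iV x) (iV y))), brV = (\<lambda>x y. snd (br0 (iV x) (iV y))),
    DelE = (\<lambda>x. tensor_map sG sV fst snd (d0 (iV x))), DelV = (\<lambda>x. tensor_map sG sG fst fst (d0 (iV x))),
    delV = (\<lambda>x. tensor_map sV sV snd snd (d0 (iV x)))\<rparr>"
  have "br ?\<Omega> u v = br0 u v" for u v
  proof -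
    obtain a x b y where uv: "u = (a, x)" "v = (b, y)"
      by (cases u, cases v)
    have "br0 (iG a + iV x) (iG b + iV y) = iG (brG a b) + br0 (iV x) (iG b) - br0 (iV y) (iG a) + br0 (iV x) (iV y)"
      using lie_bracket_skew[OF B, of "iG a" "iV y"]
      by (simp only: linear_add[OF bilin_fst[OF BD(2)]] linear_add[OF bilin_snd[OF BD(2)]] homD)
        (simp add: algebra_simps)
    then show ?thesis
      by (simp add: uv prod_eq_iff)
  qed
  then show brs: "br ?\<Omega> = br0"
    by blast
  have "d ?\<Omega> u = d0 u" for u
  proof -
    obtain a x where u: "u = (a, x)"
      by (cases u)
    have "d0 (iG a + iV x) = d0 (iG a) + d0 (iV x)"
      by (rule linear_add[OF BD(5)])
    also have "\<dots> = d ?\<Omega> (a, x)"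
      unfolding homD(2)
      by (subst skew_tensor_decomp[OF BD(6,7)]) (simp add: Let_def algebra_simps del: plus_fun_apply)
    finally show ?thesis
      by (simp add: u del: sum_cobracket.simps)
  qed
  then show ds: "d ?\<Omega> = d0"
    by blast
  have lin: "Vector_Spaces.linear sV fscale (\<lambda>x. tensor_map sC sD f g (d0 (iV x)))"
    for sC :: "'k \<Rightarrow> 'c::ab_group_add \<Rightarrow> 'c" and sD :: "'k \<Rightarrow> 'd::ab_group_add \<Rightarrow> 'd" and f g
    using linear_comp[OF linear_iV BD(5)]
    by (simp only: linear_iff tensor_map_add tensor_map_scale vector_space_fscale simp_thms)
  show "?\<Omega> \<in> LBI sG brG dG sV"
    unfolding LBI_def mem_Collect_eq brs ds
    by (simp only: ext_system.simps simp_thms)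
      (intro conjI allI B lin projection_in BD(6) bilin_linear[OF _ linear_fst] bilin_linear[OF _ linear_snd]
        bilin_comp[OF BD(2) linear_iV linear_iG] bilin_comp[OF BD(2) linear_iV linear_iV])
qed

text \<open>The map on systems is transport of structure along \<psi>. The equation for i turns
  containing \<gg>, and fixing \<gg>, in the product into the same property in E.\<close>

lemma HBI2_bij_betw_BExtd:
  fixes sE :: "'k \<Rightarrow> 'e::ab_group_add \<Rightarrow> 'e"
  assumes lin: "Vector_Spaces.linear s sE \<psi>" and "bij \<psi>" and i: "\<And>a. i a = \<psi> (iG a)"
  shows "\<exists>F. bij_betw F (HBI2 sG brG dG sV) (BExtd sG brG dG sE i)"
proof -
  let ?br = "\<lambda>\<Omega> u v. \<psi> (br \<Omega> (inv \<psi> u) (inv \<psi> v))"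
  let ?d = "\<lambda>\<Omega> u. tensor_map sE sE \<psi> \<psi> (d \<Omega> (inv \<psi> u))"
  let ?L = "LBI sG brG dG sV"
  have inv: "inv \<psi> (\<psi> u) = u" "\<psi> (inv \<psi> w) = w" for u w
    using \<open>bij \<psi>\<close> by (simp_all add: bij_is_inj bij_is_surj surj_f_inv_f)
  note linv = linear_inv[OF lin \<open>bij \<psi>\<close>]
  have hom: "lie_bialgebra_hom s (br \<Omega>) (d \<Omega>) sE (?br \<Omega>) (?d \<Omega>) \<psi>" for \<Omega>
    by (simp add: lie_bialgebra_hom_def lin inv del: sum_bracket.simps sum_cobracket.simps)
  have hom_inv: "lie_bialgebra_hom sE (?br \<Omega>) (?d \<Omega>) s (br \<Omega>) (d \<Omega>) (inv \<psi>)" if "\<Omega> \<in> ?L" for \<Omega>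
    by (rule lie_bialgebra_hom_inv[OF LBI_D(11)[OF that] hom \<open>bij \<psi>\<close>])
  have ext: "(?br \<Omega>, ?d \<Omega>) \<in> ext_structures sG brG dG sE i" if "\<Omega> \<in> ?L" for \<Omega>
    using lie_bialgebra_iso[OF LBI_D(11)[OF that] hom \<open>bij \<psi>\<close>]
      lie_bialgebra_hom_comp[OF lie_bialgebra_hom_iG[OF that] hom]
    by (simp add: ext_structures_def i[abs_def])
  have image: "(\<lambda>\<Omega>. (?br \<Omega>, ?d \<Omega>)) ` ?L = ext_structures sG brG dG sE i"
  proof
    show "(\<lambda>\<Omega>. (?br \<Omega>, ?d \<Omega>)) ` ?L \<subseteq> ext_structures sG brG dG sE i"
      using ext by blast
    show "ext_structures sG brG dG sE i \<subseteq> (\<lambda>\<Omega>. (?br \<Omega>, ?d \<Omega>)) ` ?L"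
    proof
      fix X assume "X \<in> ext_structures sG brG dG sE i"
      then obtain brE dE where X: "X = (brE, dE)" and E: "lie_bialgebra sE brE dE"
        and homE: "lie_bialgebra_hom sG brG dG sE brE dE i"
        by (auto simp: ext_structures_def)
      \<comment> \<open>The given structure is pulled back to the product, where
        \<open>LBI_exhaust\<close> finds its system; pushing forward again recovers it.\<close>
      let ?brS = "\<lambda>u v. inv \<psi> (brE (\<psi> u) (\<psi> v))"
      let ?dS = "\<lambda>u. tensor_map s s (inv \<psi>) (inv \<psi>) (dE (\<psi> u))"
      have hom0: "lie_bialgebra_hom sE brE dE s ?brS ?dS (inv \<psi>)"
        by (simp add: lie_bialgebra_hom_def linv inv)
      have "lie_bialgebra s ?brS ?dS"
        by (rule lie_bialgebra_iso[OF E hom0 bij_imp_bij_inv[OF \<open>bij \<psi>\<close>]])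
      moreover have "lie_bialgebra_hom sG brG dG s ?brS ?dS iG"
        using lie_bialgebra_hom_comp[OF homE hom0] by (simp only: i inv)
      ultimately obtain \<Omega> where \<Omega>: "\<Omega> \<in> ?L" "br \<Omega> = ?brS" "d \<Omega> = ?dS"
        by (rule LBI_exhaust)
      have "tensor_map sE sE (\<lambda>u. \<psi> (inv \<psi> u)) (\<lambda>u. \<psi> (inv \<psi> u)) (dE u) = dE u" for u
        using tensor_map_id[OF lie_bialgebraD(6)[OF E], of u] by (simp add: inv id_def)
      then have "X = (?br \<Omega>, ?d \<Omega>)"
        unfolding X \<Omega> tensor_map_comp[OF lin lin] inv by simp
      with \<Omega>(1) show "X \<in> (\<lambda>\<Omega>. (?br \<Omega>, ?d \<Omega>)) ` ?L"
        by blast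
    qed
  qed
  have rel: "(\<Omega>, \<Omega>') \<in> LBI_equiv sG brG dG sV \<longleftrightarrow>
      ((?br \<Omega>, ?d \<Omega>), (?br \<Omega>', ?d \<Omega>')) \<in> ext_equiv sG brG dG sE i"
    if \<Omega>: "\<Omega> \<in> ?L" and \<Omega>': "\<Omega>' \<in> ?L" for \<Omega> \<Omega>'
  proof -
    \<comment> \<open>Isomorphisms on the two sides correspond by conjugation with \<psi>.\<close>
    have "(\<exists>\<phi>. lie_bialgebra_hom s (br \<Omega>) (d \<Omega>) s (br \<Omega>') (d \<Omega>') \<phi> \<and> bij \<phi> \<and> (\<forall>a. \<phi> (iG a) = iG a)) \<longleftrightarrow>
      (\<exists>\<phi>. lie_bialgebra_hom sE (?br \<Omega>) (?d \<Omega>) sE (?br \<Omega>') (?d \<Omega>') \<phi> \<and> bij \<phi> \<and> (\<forall>a. \<phi> (i a) = i a))"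
      (is "(\<exists>\<phi>. ?P \<phi>) \<longleftrightarrow> (\<exists>\<phi>. ?Q \<phi>)")
    proof
      assume "\<exists>\<phi>. ?P \<phi>"
      then obtain \<phi> where \<phi>: "?P \<phi>" by blast
      have "bij (\<psi> \<circ> (\<phi> \<circ> inv \<psi>))"
        using \<phi> \<open>bij \<psi>\<close> by (intro bij_comp) (simp_all add: bij_imp_bij_inv)
      then have "bij (\<lambda>u. \<psi> (\<phi> (inv \<psi> u)))"
        by (simp only: comp_def)
      moreover have "lie_bialgebra_hom sE (?br \<Omega>) (?d \<Omega>) sE (?br \<Omega>') (?d \<Omega>') (\<lambda>u. \<psi> (\<phi> (inv \<psi> u)))"
        using lie_bialgebra_hom_comp[OF lie_bialgebra_hom_comp[OF hom_inv[OF \<Omega>]] hom] \<phi> by blast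
      ultimately have "?Q (\<lambda>u. \<psi> (\<phi> (inv \<psi> u)))"
        using \<phi> by (simp only: i inv simp_thms)
      then show "\<exists>\<phi>. ?Q \<phi>" by blast
    next
      assume "\<exists>\<phi>. ?Q \<phi>"
      then obtain \<phi> where \<phi>: "?Q \<phi>" by blast
      have "bij (inv \<psi> \<circ> (\<phi> \<circ> \<psi>))"
        using \<phi> \<open>bij \<psi>\<close> by (intro bij_comp) (simp_all add: bij_imp_bij_inv)
      then have "bij (\<lambda>u. inv \<psi> (\<phi> (\<psi> u)))"
        by (simp only: comp_def)
      moreover have "lie_bialgebra_hom s (br \<Omega>) (d \<Omega>) s (br \<Omega>') (d \<Omega>') (\<lambda>u. inv \<psi> (\<phi> (\<psi> u)))"
        using lie_bialgebra_hom_comp[OF lie_bialgebra_hom_comp[OF hom] hom_inv[OF \<Omega>']] \<phi> by blast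
      ultimately have "?P (\<lambda>u. inv \<psi> (\<phi> (\<psi> u)))"
        using \<phi> by (simp only: i inv simp_thms)
      then show "\<exists>\<phi>. ?P \<phi>" by blast
    qed
    then show ?thesis
      unfolding LBI_equiv_iff ext_equiv_def using \<Omega> \<Omega>' ext[OF \<Omega>] ext[OF \<Omega>'] by blast
  qed
  have "LBI_equiv sG brG dG sV \<subseteq> ?L \<times> ?L"
    "ext_equiv sG brG dG sE i \<subseteq> ext_structures sG brG dG sE i \<times> ext_structures sG brG dG sE i"
    by (auto simp: LBI_equiv_def ext_equiv_def)
  from bij_betw_image_quotients[OF image this rel] show ?thesis
    unfolding HBI2_def BExtd_def by blast
qed

end

section \<open>One-dimensional complements\<close>

text \<open>One-dimensionality is encoded by a generator and its coordinate: the first equation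
  makes e span V, and \<xi> e = 1 makes e nonzero. Every vector can then be rewritten as a multiple
  of e.\<close>

locale lie_bialgebra_line = lie_bialgebra_sum sG brG dG sV
  for sG :: "'k::field_char_0 \<Rightarrow> 'g::ab_group_add \<Rightarrow> 'g"
    and brG :: "'g \<Rightarrow> 'g \<Rightarrow> 'g"
    and dG :: "'g \<Rightarrow> ('k, 'g, 'g) tensor2"
    and sV :: "'k \<Rightarrow> 'v::ab_group_add \<Rightarrow> 'v" +
  fixes e :: 'v and \<xi> :: "'v \<Rightarrow> 'k"
  assumes linear_\<xi>: "Vector_Spaces.linear sV (*) \<xi>"
    and scale_\<xi> [simp]: "sV (\<xi> x) e = x"
    and \<xi>_e [simp]: "\<xi> e = 1"
begin

lemmas \<xi>_simps = linear_add[OF linear_\<xi>] linear_diff[OF linear_\<xi>] linear_neg[OF linear_\<xi>]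
  linear_0[OF linear_\<xi>] linear_scale[OF linear_\<xi>]

section \<open>Systems on a line, and tensors with a factor in it\<close>

definition flag_system ::
  "('g \<Rightarrow> 'k) \<Rightarrow> ('g \<Rightarrow> 'g) \<Rightarrow> 'g \<Rightarrow> ('k, 'g, 'g) tensor2 \<Rightarrow> ('k, 'g, 'v) ext_system"
  where "flag_system \<alpha> D A B = \<lparr>ract = (\<lambda>x a. sV (\<alpha> a) x), lact = (\<lambda>x a. sG (\<xi> x) (D a)),
    cocyc = (\<lambda>x y. 0), brV = (\<lambda>x y. 0), DelE = (\<lambda>x. tensor sG sV A x),
    DelV = (\<lambda>x. fscale (\<xi> x) B), delV = (\<lambda>x. 0)\<rparr>"

lemma flag_system_sel [simp]:
  "ract (flag_system \<alpha> D A B) x a = sV (\<alpha> a) x"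
  "lact (flag_system \<alpha> D A B) x a = sG (\<xi> x) (D a)"
  "cocyc (flag_system \<alpha> D A B) x y = 0"
  "brV (flag_system \<alpha> D A B) x y = 0"
  "DelE (flag_system \<alpha> D A B) x = tensor sG sV A x"
  "DelV (flag_system \<alpha> D A B) x = fscale (\<xi> x) B"
  "delV (flag_system \<alpha> D A B) x = 0"
  by (simp_all add: flag_system_def)

text \<open>Moving the coordinate of the second factor to the first makes that factor equal to e,
  and tensors sharing a second factor add up to a pure tensor.\<close>

lemma tensor_line:
  assumes "t \<in> tensor_space sG sV"
  obtains A where "t = tensor sG sV A e"
proof -
  note T = tensor_linear[OF G(1) vector_space_V]
  have "\<exists>A. t = tensor sG sV A e"
    using assms
  proof (induction t rule: tensor_space_span_induct)
    case (pure a b)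
    have "tensor sG sV a b = tensor sG sV (sG (\<xi> b) a) e"
      using T(8)[of a "\<xi> b" e] by (simp add: T(7))
    then show ?case by blast
  next
    case (add t u)
    then show ?case using T(1) by metis
  next
    case (scale c t)
    then show ?case using T(7) by metis
  qed
  then show thesis using that by blast
qed

text \<open>Pairing with l \<otimes> \<xi> recovers l a for every linear form l, and linear forms
  separate points.\<close>

lemma tensor_line_inject:
  assumes "tensor sG sV a e = tensor sG sV b e"
  shows "a = b"
proof (rule linear_forms_separate[OF G(1)])
  fix l assume l: "Vector_Spaces.linear sG (*) l"
  have "bilin sG sV (*) (\<lambda>a x. l a * \<xi> x)"
    by (simp add: bilin_form_iff G(1) vector_space_V \<xi>_simps linear_add[OF l] linear_scale[OF l] algebra_simps)
  then show "l a = l b"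
    using fun_cong[OF assms, of "\<lambda>a x. l a * \<xi> x"] by (simp add: tensor_def)
qed

text \<open>Every bilinear form on a line is symmetric, so the flip acts trivially and a skew tensor
  equals its own negative. Characteristic 0 then makes it vanish.\<close>

lemma skew_tensor_line:
  assumes "t \<in> tensor_space sV sV" "flip t = - t"
  shows "t = 0"
proof (rule tensor_space_eqI[OF assms(1) tensor_space_0])
  fix \<phi> assume \<phi>: "bilin sV sV (*) \<phi>"
  have "\<phi> x y = \<phi> y x" for x y
  proof -
    have "\<phi> (sV (\<xi> x) e) (sV (\<xi> y) e) = \<phi> (sV (\<xi> y) e) (sV (\<xi> x) e)"
      unfolding linear_scale[OF bilin_fst[OF \<phi>]] linear_scale[OF bilin_snd[OF \<phi>]] by simp
    then show ?thesis by simp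
  qed
  then have "(\<lambda>x y. \<phi> y x) = \<phi>"
    by (intro ext)
  then have "flip t \<phi> = t \<phi>"
    by (simp only: flip_def)
  then show "t \<phi> = 0 \<phi>"
    using assms(2) by simp
qed

text \<open>By linearity in x, everything is determined at e: \<alpha> is the coordinate of
  \<open>ract \<Omega> e\<close>, D is \<open>lact \<Omega> e\<close>, B is
  \<open>DelV \<Omega> e\<close>, and A is the left factor of \<open>DelE \<Omega> e\<close> found
  by \<open>tensor_line\<close>.\<close>

lemma LBI_eq_flag_system:
  assumes "\<Omega> \<in> LBI sG brG dG sV"
  obtains \<alpha> D A B where "Vector_Spaces.linear sG (*) \<alpha>" "Vector_Spaces.linear sG sG D"
    "B \<in> tensor_space sG sG" "\<Omega> = flag_system \<alpha> D A B"
proof -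
  note D = LBI_D[OF assms]
  note LD = lie_bialgebraD[OF D(11)]
  obtain A where A: "DelE \<Omega> e = tensor sG sV A e"
    using tensor_line[OF D(6)] by blast
  \<comment> \<open>The two components of [e, e] = 0 in the sum.\<close>
  have ee: "cocyc \<Omega> e e = 0" "brV \<Omega> e e = 0"
    using LD(3)[of "(0, e)"] by (simp_all add: zero_prod_def G(3))
  have e1: "ract \<Omega> x a = sV (\<xi> (ract \<Omega> e a)) x" for x a
  proof -
    have "sV (\<xi> (ract \<Omega> e a)) (sV (\<xi> x) e) = sV (\<xi> x) (sV (\<xi> (ract \<Omega> e a)) e)"
      by (rule module.scale_left_commute[OF vector_space_module[OF vector_space_V]])
    also have "\<dots> = ract \<Omega> (sV (\<xi> x) e) a"
      by (subst linear_scale[OF bilin_fst[OF D(1)]]) (simp only: scale_\<xi>)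
    finally show ?thesis by (simp only: scale_\<xi>)
  qed
  have e2: "lact \<Omega> x a = sG (\<xi> x) (lact \<Omega> e a)" for x a
    using linear_scale[OF bilin_fst[OF D(2)], of "\<xi> x" e a] by simp
  have e3: "cocyc \<Omega> x y = 0" for x y
  proof -
    have "cocyc \<Omega> (sV (\<xi> x) e) (sV (\<xi> y) e) = 0"
      by (simp only: linear_scale[OF bilin_fst[OF D(3)]] linear_scale[OF bilin_snd[OF D(3)]] ee
        module.scale_zero_right[OF vector_space_module[OF G(1)]])
    then show ?thesis by simp
  qed
  have e4: "brV \<Omega> x y = 0" for x y
  proof -
    have "brV \<Omega> (sV (\<xi> x) e) (sV (\<xi> y) e) = 0"
      by (simp only: linear_scale[OF bilin_fst[OF D(4)]] linear_scale[OF bilin_snd[OF D(4)]] ee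
        module.scale_zero_right[OF vector_space_module[OF vector_space_V]])
    then show ?thesis by simp
  qed
  have e5: "DelE \<Omega> x = tensor sG sV A x" for x
    using linear_scale[OF D(5), of "\<xi> x" e] tensor_scale_right[OF G(1) vector_space_V, of A "\<xi> x" e]
    by (simp add: A)
  have e6: "DelV \<Omega> x = fscale (\<xi> x) (DelV \<Omega> e)" for x
    using linear_scale[OF D(7), of "\<xi> x" e] by simp
  \<comment> \<open>\<open>delV \<Omega> x\<close> is a component of a skew tensor with the same
    projection on both legs, hence skew itself.\<close>
  have e7: "delV \<Omega> x = 0" for x
  proof (rule skew_tensor_line[OF D(10)])
    show "flip (delV \<Omega> x) = - delV \<Omega> x"
      using d_snd_snd[of \<Omega> x 0, OF D(6,8,10)] flip_tensor_map[of sV sV snd snd "d \<Omega> (0, x)"] LD(7)[of "(0, x)"]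
      by (simp only: tensor_map_neg)
  qed
  have "\<Omega> = flag_system (\<lambda>a. \<xi> (ract \<Omega> e a)) (lact \<Omega> e) A (DelV \<Omega> e)" (is "\<Omega> = ?F")
  proof (rule ext_system.equality)
    show "ract \<Omega> = ract ?F" by (intro ext) (simp only: flag_system_sel e1[symmetric])
    show "lact \<Omega> = lact ?F" by (intro ext) (simp only: flag_system_sel e2[symmetric])
    show "cocyc \<Omega> = cocyc ?F" "brV \<Omega> = brV ?F"
      by (intro ext; simp only: flag_system_sel e3 e4)+
    show "DelE \<Omega> = DelE ?F" by (rule ext) (simp only: flag_system_sel e5)
    show "DelV \<Omega> = DelV ?F" by (rule ext) (simp only: flag_system_sel e6[symmetric])
    show "delV \<Omega> = delV ?F" by (rule ext) (simp only: flag_system_sel e7)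
  qed simp
  then show thesis
    using that[OF linear_comp[OF bilin_snd[OF D(1)] linear_\<xi>] bilin_snd[OF D(2)] D(8)] by blast
qed

section \<open>The Lie bialgebra axioms of a flag system, translated into the axioms of a flag
  datum\<close>

context
  fixes \<alpha> :: "'g \<Rightarrow> 'k" and D :: "'g \<Rightarrow> 'g" and A :: 'g and B :: "('k, 'g, 'g) tensor2"
  assumes \<alpha>: "Vector_Spaces.linear sG (*) \<alpha>" and D: "Vector_Spaces.linear sG sG D"
    and B: "B \<in> tensor_space sG sG"
begin

abbreviation \<Phi> :: "('k, 'g, 'v) ext_system"
  where "\<Phi> \<equiv> flag_system \<alpha> D A B"

lemma flag_system_components:
  "bilin sV sG sV (ract \<Phi>)" "bilin sV sG sG (lact \<Phi>)"
  "bilin sV sV sG (cocyc \<Phi>)" "bilin sV sV sV (brV \<Phi>)"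
  "Vector_Spaces.linear sV fscale (DelE \<Phi>)" "DelE \<Phi> x \<in> tensor_space sG sV"
  "Vector_Spaces.linear sV fscale (DelV \<Phi>)" "DelV \<Phi> x \<in> tensor_space sG sG"
  "Vector_Spaces.linear sV fscale (delV \<Phi>)" "delV \<Phi> x \<in> tensor_space sV sV"
proof -
  interpret G: vector_space sG by (rule G(1))
  interpret V: vector_space sV by (rule vector_space_V)
  show "bilin sV sG sV (ract \<Phi>)" "bilin sV sG sG (lact \<Phi>)"
    "bilin sV sV sG (cocyc \<Phi>)" "bilin sV sV sV (brV \<Phi>)"
    using \<alpha> D vector_space_V by (simp_all add: bilin_def linear_iff \<xi>_simps algebra_simps)
  show "Vector_Spaces.linear sV fscale (DelE \<Phi>)"
    using bilin_snd[OF bilin_tensor[OF G(1) vector_space_V], of A] by (simp add: linear_iff)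
  show "DelE \<Phi> x \<in> tensor_space sG sV" "DelV \<Phi> x \<in> tensor_space sG sG" "delV \<Phi> x \<in> tensor_space sV sV"
    by (simp_all add: B tensor_in tensor_space_0 tensor_space_scale)
  show "Vector_Spaces.linear sV fscale (DelV \<Phi>)" "Vector_Spaces.linear sV fscale (delV \<Phi>)"
    using vector_space_fscale by (simp_all add: linear_iff vector_space_V \<xi>_simps fscale_def fun_eq_iff algebra_simps)
qed

lemma bilin_br_flag: "bilin s s s (br \<Phi>)"
proof -
  interpret G: vector_space sG by (rule G(1))
  interpret V: vector_space sV by (rule vector_space_V)
  show ?thesis
    by (auto simp: bilin_def linear_iff[of s s] vector_space_s s_apply \<xi>_simps
        linear_add[OF \<alpha>] linear_add[OF D] linear_scale[OF \<alpha>] linear_scale[OF D]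
        linear_add[OF bilin_fst[OF G(2)]] linear_scale[OF bilin_fst[OF G(2)]]
        linear_add[OF bilin_snd[OF G(2)]] linear_scale[OF bilin_snd[OF G(2)]] algebra_simps)
qed

lemma lie_algebra_flag_iff:
  "lie_algebra s (br \<Phi>) \<longleftrightarrow> (\<forall>a b. \<alpha> (brG a b) = 0) \<and>
    (\<forall>a b. D (brG a b) = brG (D a) b + brG a (D b) + sG (\<alpha> a) (D b) - sG (\<alpha> b) (D a))"
  (is "?L \<longleftrightarrow> ?R")
proof -
  interpret G: vector_space sG by (rule G(1))
  interpret V: vector_space sV by (rule vector_space_V)
  note lin = \<xi>_simps
    linear_add[OF \<alpha>] linear_scale[OF \<alpha>] linear_diff[OF \<alpha>] linear_neg[OF \<alpha>] linear_0[OF \<alpha>]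
    linear_add[OF D] linear_scale[OF D] linear_diff[OF D] linear_neg[OF D] linear_0[OF D]
    linear_add[OF bilin_fst[OF G(2)]] linear_scale[OF bilin_fst[OF G(2)]]
    linear_diff[OF bilin_fst[OF G(2)]] linear_neg[OF bilin_fst[OF G(2)]] linear_0[OF bilin_fst[OF G(2)]]
    linear_add[OF bilin_snd[OF G(2)]] linear_scale[OF bilin_snd[OF G(2)]]
    linear_diff[OF bilin_snd[OF G(2)]] linear_neg[OF bilin_snd[OF G(2)]] linear_0[OF bilin_snd[OF G(2)]]
  note skew = lie_bracket_skew[OF lie_bialgebra_G]
  show ?thesis
  proof
    assume ?L
    \<comment> \<open>With [e, a] = D a + \<alpha>(a) e, the V coordinate of this identity is
      \<alpha>([a, b]), the products \<alpha>(a) \<alpha>(b) cancelling, and its \<gg> component is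
      the rule for D on brackets.\<close>
    then have jac: "br \<Phi> (a, 0) (br \<Phi> (b, 0) (0, e)) + br \<Phi> (b, 0) (br \<Phi> (0, e) (a, 0))
      + br \<Phi> (0, e) (br \<Phi> (a, 0) (b, 0)) = 0" for a b
      by (simp only: lie_algebra_def)
    have "\<alpha> (brG a b) = 0 \<and>
      D (brG a b) = brG (D a) b + brG a (D b) + sG (\<alpha> a) (D b) - sG (\<alpha> b) (D a)" for a b
    proof -
      have "\<xi> (snd (br \<Phi> (a, 0) (br \<Phi> (b, 0) (0, e)) + br \<Phi> (b, 0) (br \<Phi> (0, e) (a, 0))
          + br \<Phi> (0, e) (br \<Phi> (a, 0) (b, 0)))) = 0"
        unfolding jac by (simp add: \<xi>_simps)
      moreover have "fst (br \<Phi> (a, 0) (br \<Phi> (b, 0) (0, e)) + br \<Phi> (b, 0) (br \<Phi> (0, e) (a, 0))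
          + br \<Phi> (0, e) (br \<Phi> (a, 0) (b, 0))) = 0"
        unfolding jac by simp
      ultimately show ?thesis
        using skew[of b "D a"] by (simp add: lin algebra_simps)
    qed
    then show ?R by blast
  next
    assume R: ?R
    show ?L
      unfolding lie_algebra_def
    proof (intro conjI allI vector_space_s bilin_br_flag)
      show "br \<Phi> u u = 0" for u
        by (cases u) (simp add: G(3) zero_prod_def)
      fix u v w :: "'g \<times> 'v"
      obtain a x b y c z where uvw: "u = (a, x)" "v = (b, y)" "w = (c, z)"
        by (cases u, cases v, cases w)
      have jac: "brG a (brG b c) = - brG b (brG c a) - brG c (brG a b)"
        using G(4)[of a b c] by (simp add: eq_neg_iff_add_eq_0 algebra_simps)
      \<comment> \<open>Both vectors are multiples of e, so their coordinates can be exchanged. This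
        cancels the V-valued terms with coefficients such as \<alpha>(D b), which arise when two
        arguments have V parts.\<close>
      have swap: "sV (\<xi> x * r) y = sV (\<xi> y * r) x" for x y r
      proof -
        have "sV (\<xi> x * r) (sV (\<xi> y) e) = sV (\<xi> y * r) (sV (\<xi> x) e)"
          unfolding V.scale_scale by (simp only: ac_simps)
        then show ?thesis by simp
      qed
      show "br \<Phi> u (br \<Phi> v w) + br \<Phi> v (br \<Phi> w u) + br \<Phi> w (br \<Phi> u v) = 0"
        unfolding uvw
        using skew[of b "D a"] skew[of c "D a"] skew[of c "D b"] skew[of a "D b"] skew[of a "D c"] skew[of b "D c"]
          swap[of x "\<alpha> (D b)" z] swap[of y "\<alpha> (D c)" x] swap[of z "\<alpha> (D a)" y]
        by (simp add: lin R jac zero_prod_def algebra_simps)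
    qed
  qed
qed

lemma d_flag:
  "d \<Phi> (a, x) = tensor_map s s iG iG (dG a) + tensor s s (iG A) (iV x) - tensor s s (iV x) (iG A)
    + fscale (\<xi> x) (tensor_map s s iG iG B)"
  using tensor_map_tensor[OF linear_iG linear_iV, of A x]
  by (simp add: Let_def tensor_map_scale flip_tensor tensor_map_0 del: zero_fun_apply)

lemma d_flag_apply:
  assumes "bilin s s (*) \<phi>"
  shows "d \<Phi> (a, x) \<phi> = dG a (\<lambda>u v. \<phi> (iG u) (iG v)) + \<phi> (iG A) (iV x) - \<phi> (iV x) (iG A)
    + \<xi> x * B (\<lambda>u v. \<phi> (iG u) (iG v))"
  unfolding d_flag using assms by (simp add: tensor_map_def tensor_def fscale_def)

lemma d_flag_iG_apply:
  assumes "bilin s s (*) \<phi>"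
  shows "d \<Phi> (iG a) \<phi> = dG a (\<lambda>u v. \<phi> (iG u) (iG v))"
  unfolding d_flag_apply[OF assms]
  using linear_0[OF bilin_fst[OF assms]] linear_0[OF bilin_snd[OF assms]]
  by (simp add: \<xi>_simps zero_prod_def)

lemma d_flag_iG: "d \<Phi> (a, 0) = tensor_map s s iG iG (dG a)"
  by (rule ext) (simp only: d_flag, simp add: \<xi>_simps fscale_def
    tensor_0_left[OF vector_space_s vector_space_s] tensor_0_right[OF vector_space_s vector_space_s]
    flip: zero_prod_def)

lemma br_flag_iG: "br \<Phi> (a, 0) (b, 0) = (brG a b, 0)"
  by (simp add: \<xi>_simps module.scale_zero_left[OF vector_space_module[OF G(1)]]
    module.scale_zero_right[OF vector_space_module[OF vector_space_V]])

lemma ad_tensor_iG: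
  "ad_tensor s (br \<Phi>) (a, 0) (tensor_map s s iG iG t) = tensor_map s s iG iG (ad_tensor sG brG a t)"
  by (rule ad_tensor_natural[OF linear_iG G(2) bilin_br_flag, symmetric]) (simp only: br_flag_iG)

lemma d_flag_in: "d \<Phi> u \<in> tensor_space s s"
  by (cases u) (simp only: d_in[OF flag_system_components(6,8,10)])

lemma linear_d_flag: "Vector_Spaces.linear s fscale (d \<Phi>)"
proof -
  have "d \<Phi> (u + v) = d \<Phi> u + d \<Phi> v" for u v
    by (cases u, cases v)
      (simp add: d_flag linear_add[OF G(5)] tensor_map_add \<xi>_simps
        tensor_add_left[OF vector_space_s vector_space_s, of "(0, _)" "(0, _)", simplified]
        tensor_add_right[OF vector_space_s vector_space_s, of _ "(0, _)" "(0, _)", simplified]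
        del: sum_cobracket.simps, simp add: fun_eq_iff fscale_def algebra_simps)
  moreover have "d \<Phi> (s c u) = fscale c (d \<Phi> u)" for c u
    using tensor_scale_left[OF vector_space_s vector_space_s, of c "(0, snd u)"]
      tensor_scale_right[OF vector_space_s vector_space_s, of _ c "(0, snd u)"]
      module.scale_zero_right[OF vector_space_module[OF G(1)], of c]
    by (cases u) (simp add: s_apply d_flag linear_scale[OF G(5)] tensor_map_scale \<xi>_simps
        del: sum_cobracket.simps, simp add: fun_eq_iff fscale_def algebra_simps)
  ultimately show ?thesis
    by (simp add: linear_iff vector_space_s vector_space_fscale del: sum_cobracket.simps)
qed

lemma flip_d_flag:
  assumes "flip B = - B"
  shows "flip (d \<Phi> u) = - d \<Phi> u"
  by (cases u) (simp add: d_flag flip_add flip_diff flip_tensor flip_scale flip_tensor_map G(7) assms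
    tensor_map_neg del: sum_cobracket.simps, simp add: fun_eq_iff fscale_def)

lemma lie_coalgebra_flag_iff:
  "lie_coalgebra s (d \<Phi>) \<longleftrightarrow> flip B = - B \<and> dG A = 0 \<and>
    vec_tensor sG A B - flip12 (vec_tensor sG A B) + tensor_vec sG B A
      + (id_tensor sG dG B - flip12 (id_tensor sG dG B) - tensor_id sG dG B) = 0"
  (is "_ \<longleftrightarrow> _ \<and> _ \<and> ?E = 0")
proof -
  let ?J = "\<lambda>u. id_tensor s (d \<Phi>) (d \<Phi> u) - flip12 (id_tensor s (d \<Phi>) (d \<Phi> u)) - tensor_id s (d \<Phi>) (d \<Phi> u)"
  note triG = trilin_form_comp[OF _ linear_iG linear_iG linear_iG]
  \<comment> \<open>The terms from a cancel by co-Jacobi in \<gg>, and those with two factors A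
    cancel among themselves. What remains is \<xi> x times the equation for B, together with one
    copy of the cobracket of A for each position of x. These lie in different summands of the triple
    tensor product, so they can be separated by suitable forms.\<close>
  have J: "?J (a, x) \<phi> = \<xi> x * ?E (\<lambda>u v w. \<phi> (iG u) (iG v) (iG w))
      - dG A (\<lambda>u v. \<phi> (iV x) (iG u) (iG v)) + dG A (\<lambda>u v. \<phi> (iG u) (iV x) (iG v))
      - dG A (\<lambda>u v. \<phi> (iG u) (iG v) (iV x))" if \<phi>: "trilin_form s \<phi>" for a x \<phi>
  proof -
    note \<phi>' = trilin_form_swap[THEN iffD2, OF \<phi>]
    note eval = d_flag_apply[OF bilin_id_tensor(1)[OF linear_d_flag d_flag_in \<phi>]]
      d_flag_apply[OF bilin_id_tensor(1)[OF linear_d_flag d_flag_in \<phi>']]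
      d_flag_apply[OF bilin_id_tensor(2)[OF linear_d_flag d_flag_in \<phi>]]
      d_flag_iG_apply[OF trilin_form_bilin(1)[OF \<phi>]] d_flag_iG_apply[OF trilin_form_bilin(2)[OF \<phi>]]
      d_flag_iG_apply[OF trilin_form_bilin(3)[OF \<phi>]]
      d_flag_apply[OF trilin_form_bilin(1)[OF \<phi>]] d_flag_apply[OF trilin_form_bilin(2)[OF \<phi>]]
      d_flag_apply[OF trilin_form_bilin(3)[OF \<phi>]]
    have "(id_tensor sG dG (dG a) - flip12 (id_tensor sG dG (dG a))) (\<lambda>u v w. \<phi> (iG u) (iG v) (iG w))
        = tensor_id sG dG (dG a) (\<lambda>u v w. \<phi> (iG u) (iG v) (iG w))"
      by (simp only: G(8))
    moreover have "\<phi> (0, 0) v w = 0" "\<phi> u (0, 0) w = 0" "\<phi> u v (0, 0) = 0" for u v w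
      using linear_0[OF bilin_fst[OF trilin_form_bilin(2)[OF \<phi>]], of v w]
        linear_0[OF bilin_fst[OF trilin_form_bilin(1)[OF \<phi>]], of u w]
        linear_0[OF bilin_snd[OF trilin_form_bilin(1)[OF \<phi>]], of u v]
      by (simp_all add: zero_prod_def)
    ultimately show ?thesis
      by (simp add: id_tensor_def tensor_id_def vec_tensor_def tensor_vec_def flip12_def \<phi> \<phi>' triG[OF \<phi>]
        triG[OF \<phi>'] eval linear_0[OF linear_\<xi>] linear_0[OF G(5)] algebra_simps del: sum_cobracket.simps)
  qed
  \<comment> \<open>Off trilinear forms every term has the default value 0, including the flipped
    ones, since exchanging arguments preserves trilinearity.\<close>
  have J0: "?J u \<phi> = 0" if "\<not> trilin_form s \<phi>" for u \<phi>
    using that trilin_form_swap[of s \<phi>]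
    by (simp add: id_tensor_def tensor_id_def flip12_def)
  have E0: "?E \<psi> = 0" if "\<not> trilin_form sG \<psi>" for \<psi>
    using that trilin_form_swap[of sG \<psi>]
    by (simp add: id_tensor_def tensor_id_def vec_tensor_def tensor_vec_def flip12_def)
  show ?thesis
  proof
    assume L: "lie_coalgebra s (d \<Phi>)"
    then have "d \<Phi> u = - flip (d \<Phi> u)" and cojac: "?J u = 0" for u
      unfolding lie_coalgebra_def right_minus_eq by blast+
    from arg_cong[OF this(1), of uminus] have skew: "flip (d \<Phi> u) = - d \<Phi> u" for u
      by (simp only: minus_minus)
    have "tensor_map sG sG fst fst (d \<Phi> (0, e)) = B"
      by (simp only: d_fst_fst[OF flag_system_components(6,8,10)] linear_0[OF G(5)])
        (simp add: fscale_def)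
    then have "flip B = - B"
      using flip_tensor_map[of sG sG fst fst "d \<Phi> (0, e)"] skew[of "(0, e)"]
      by (simp only: tensor_map_neg)
    moreover have dA: "dG A = 0"
    proof (rule tensor_space_eqI[OF G(6) tensor_space_0])
      fix \<psi> assume \<psi>: "bilin sG sG (*) \<psi>"
      \<comment> \<open>this form only sees the \<open>V \<otimes> \<gg> \<otimes> \<gg>\<close> component of the co-Jacobi identity\<close>
      let ?\<phi> = "\<lambda>u v w. \<xi> (snd u) * \<psi> (fst v) (fst w)"
      have "trilin_form s ?\<phi>"
        using \<psi> vector_space_s vector_space_mult
        by (simp add: trilin_form_def linear_iff bilin_form_iff s_apply \<xi>_simps algebra_simps)
      from J[OF this, of 0 e] show "dG A \<psi> = 0 \<psi>"
        unfolding cojac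
        by (simp add: \<xi>_simps id_tensor_def tensor_id_def vec_tensor_def tensor_vec_def flip12_def
            tensor_eval_0[OF B] tensor_eval_0[OF G(6)] cong: if_cong)
    qed
    moreover have "?E = 0"
    proof
      fix \<psi>
      show "?E \<psi> = 0 \<psi>"
      proof (cases "trilin_form sG \<psi>")
        case True
        \<comment> \<open>Pulled back along \<open>fst\<close>, the form sees only \<gg> parts, and
          \<xi> e = 1 leaves exactly \<open>?E\<close>.\<close>
        from J[OF trilin_form_comp[OF this linear_fst linear_fst linear_fst], of 0 e] show ?thesis
          unfolding cojac dA by simp
      next
        case False
        then show ?thesis
          using E0[OF False] by (simp only: zero_fun_apply)
      qed
    qed
    ultimately show "flip B = - B \<and> dG A = 0 \<and> ?E = 0"
      by blast
  next
    assume R: "flip B = - B \<and> dG A = 0 \<and> ?E = 0"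
    have "?J u = 0" for u
    proof
      fix \<phi>
      obtain a x where "u = (a, x)" by (cases u)
      then show "?J u \<phi> = 0 \<phi>"
        using J[of \<phi> a x] J0[of \<phi>] R by (cases "trilin_form s \<phi>") auto
    qed
    moreover have "flip (d \<Phi> u) = - d \<Phi> u" for u
      using R by (intro flip_d_flag) blast
    ultimately show "lie_coalgebra s (d \<Phi>)"
      unfolding lie_coalgebra_def
      by (intro conjI allI vector_space_s linear_d_flag d_flag_in)
        (simp_all only: minus_minus right_minus_eq)
  qed
qed

text \<open>Both sides are skew, so three components decide. The V \<otimes> V component is 0 on
  both sides, \<gg> \<otimes> V gives the formula for [a, A], and \<gg> \<otimes> \<gg> gives the
  equation for B.\<close>

lemma compatibility_flag_iff:
  assumes "flip B = - B"
  shows "d \<Phi> (br \<Phi> (a, 0) (0, e)) = ad_tensor s (br \<Phi>) (a, 0) (d \<Phi> (0, e)) - ad_tensor s (br \<Phi>) (0, e) (d \<Phi> (a, 0))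
    \<longleftrightarrow> brG a A = tensor_lift sG (\<lambda>u v. sG (\<alpha> v) u) (dG a) \<and>
      tensor sG sG (D a) A - tensor sG sG A (D a) + fscale (\<alpha> a) B + ad_tensor sG brG a B
        + dG (D a) - tensor_map sG sG D id (dG a) - tensor_map sG sG id D (dG a) = 0"
    (is "?l = ?r \<longleftrightarrow> _")
proof -
  have bil: "bilin sG sG sG (\<lambda>u v. sG (\<alpha> v) u)"
  proof -
    interpret G: vector_space sG by (rule G(1))
    show ?thesis
      using \<alpha> by (simp add: bilin_def linear_iff algebra_simps)
  qed
  note lift = tensor_lift_universal[OF bil]
  note TG = tensor_linear[OF G(1) G(1)] and TV = tensor_linear[OF G(1) vector_space_V]
    and TVV = tensor_linear[OF vector_space_V vector_space_V]
  have idG: "Vector_Spaces.linear sG sG id"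
    by (rule linear_id[OF G(1)])
  have linD: "Vector_Spaces.linear sG s (\<lambda>u. (D u, sV (\<alpha> u) e))"
  proof -
    interpret G: vector_space sG by (rule G(1))
    interpret V: vector_space sV by (rule vector_space_V)
    show ?thesis
      using \<alpha> D vector_space_s by (simp add: linear_iff s_apply algebra_simps)
  qed
  have lin\<alpha>: "Vector_Spaces.linear sG sV (\<lambda>u. sV (\<alpha> u) e)"
    using linear_comp[OF linD linear_snd] by simp
  \<comment> \<open>This brings the Sweedler sum into the \<gg> \<otimes> V component: moving the
    scalar \<alpha> of the second leg to the first leaves e as common right factor.\<close>
  have t\<alpha>: "tensor_map sG sV id (\<lambda>u. sV (\<alpha> u) e) t = tensor sG sV (tensor_lift sG (\<lambda>u v. sG (\<alpha> v) u) t) e"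
    if "t \<in> tensor_space sG sG" for t
    using that
  proof (induction t rule: tensor_space_span_induct)
    case (pure u v)
    show ?case
      by (simp only: lift(1) tensor_map_tensor[OF idG lin\<alpha>] TV(7,8)) (simp only: id_apply)
  next
    case (add t u)
    then show ?case
      by (simp only: lift(2) tensor_map_add TV(1))
  next
    case (scale c t)
    then show ?case
      by (simp only: lift(3) tensor_map_scale TV(7))
  qed
  have l: "?l = d \<Phi> (- D a, - sV (\<alpha> a) e)"
    by (simp add: \<xi>_simps linear_0[OF D] linear_0[OF \<alpha>] linear_0[OF bilin_snd[OF G(2)]]
      module.scale_zero_left[OF vector_space_module[OF G(1)]]
      module.scale_zero_left[OF vector_space_module[OF vector_space_V]]
      module.scale_one[OF vector_space_module[OF G(1)]] del: sum_cobracket.simps)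
  have br_e: "br \<Phi> (a, 0) (0, e) = (- D a, - sV (\<alpha> a) e)" "br \<Phi> (0, e) (u, 0) = (D u, sV (\<alpha> u) e)"
    "br \<Phi> (a, 0) (u, 0) = (brG a u, 0)" for u
    by (simp_all add: \<xi>_simps linear_0[OF D] linear_0[OF \<alpha>] linear_0[OF bilin_snd[OF G(2)]]
      linear_0[OF bilin_fst[OF G(2)]]
      module.scale_zero_left[OF vector_space_module[OF G(1)]]
      module.scale_zero_right[OF vector_space_module[OF vector_space_V]]
      module.scale_zero_left[OF vector_space_module[OF vector_space_V]]
      module.scale_one[OF vector_space_module[OF G(1)]])
  have de: "d \<Phi> (0, e) = tensor s s (A, 0) (0, e) - tensor s s (0, e) (A, 0) + tensor_map s s iG iG B"
    by (simp only: d_flag linear_0[OF G(5)] tensor_map_0 \<xi>_e) (simp add: fun_eq_iff fscale_def)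
  have ade: "ad_tensor s (br \<Phi>) (0, e) (tensor_map s s iG iG t) =
    tensor_map s s (\<lambda>u. (D u, sV (\<alpha> u) e)) iG t + tensor_map s s iG (\<lambda>u. (D u, sV (\<alpha> u) e)) t" for t
    by (simp only: ad_tensor_def tensor_map_comp[OF bilin_snd[OF bilin_br_flag] linear_id[OF vector_space_s]]
      tensor_map_comp[OF linear_id[OF vector_space_s] bilin_snd[OF bilin_br_flag]] br_e id_apply)
  have r: "?r = tensor s s (brG a A, 0) (0, e) + tensor s s (A, 0) (- D a, - sV (\<alpha> a) e)
    - (tensor s s (- D a, - sV (\<alpha> a) e) (A, 0) + tensor s s (0, e) (brG a A, 0))
    + tensor_map s s iG iG (ad_tensor sG brG a B)
    - (tensor_map s s (\<lambda>u. (D u, sV (\<alpha> u) e)) iG (dG a) + tensor_map s s iG (\<lambda>u. (D u, sV (\<alpha> u) e)) (dG a))"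
    by (simp only: de d_flag_iG ad_tensor_add ad_tensor_diff ad_tensor_tensor[OF bilin_br_flag] br_e ad_tensor_iG ade)
  note proj = tensor_map_add tensor_map_diff tensor_map_tensor[OF linear_fst linear_fst]
    tensor_map_tensor[OF linear_fst linear_snd] tensor_map_tensor[OF linear_snd linear_snd]
    tensor_map_comp[OF linear_fst linear_fst] tensor_map_comp[OF linear_fst linear_snd]
    tensor_map_comp[OF linear_snd linear_snd] fst_conv snd_conv TG TV TVV
    tensor_map_zero[OF G(6)] tensor_map_zero[OF ad_tensor_in[OF G(2) B]]
    t\<alpha>[OF G(6), unfolded id_def] tensor_map_id[OF ad_tensor_in[OF G(2) B], unfolded id_def]
  have l_fst_fst: "tensor_map sG sG fst fst ?l = - dG (D a) - fscale (\<alpha> a) B"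
    unfolding l d_fst_fst[OF flag_system_components(6,8,10)]
    by (simp add: linear_neg[OF G(5)] \<xi>_simps) (simp add: fun_eq_iff fscale_def)
  have l_fst_snd: "tensor_map sG sV fst snd ?l = - fscale (\<alpha> a) (tensor sG sV A e)"
    unfolding l d_fst_snd[OF flag_system_components(6,8,10)] by (simp only: flag_system_sel TV)
  have l_snd_snd: "tensor_map sV sV snd snd ?l = 0"
    unfolding l d_snd_snd[OF flag_system_components(6,8,10)] by (simp only: flag_system_sel)
  have r_fst_fst: "tensor_map sG sG fst fst ?r = tensor sG sG (D a) A - tensor sG sG A (D a)
    + ad_tensor sG brG a B - tensor_map sG sG D id (dG a) - tensor_map sG sG id D (dG a)"
    unfolding r by (simp only: proj) (simp add: id_def algebra_simps del: plus_fun_apply)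
  have r_fst_snd: "tensor_map sG sV fst snd ?r = tensor sG sV (brG a A) e - fscale (\<alpha> a) (tensor sG sV A e)
    - tensor sG sV (tensor_lift sG (\<lambda>u v. sG (\<alpha> v) u) (dG a)) e"
    unfolding r by (simp only: proj) (simp del: plus_fun_apply)
  have r_snd_snd: "tensor_map sV sV snd snd ?r = 0"
    unfolding r by (simp only: proj) (simp add: fscale_def fun_eq_iff)
  have mem: "?l \<in> tensor_space s s" "flip ?l = - ?l" "?r \<in> tensor_space s s" "flip ?r = - ?r"
  proof -
    show "?l \<in> tensor_space s s" "flip ?l = - ?l"
      by (rule d_flag_in, rule flip_d_flag[OF assms])
    show "?r \<in> tensor_space s s"
      by (intro tensor_space_diff ad_tensor_in[OF bilin_br_flag] d_flag_in)
    show "flip ?r = - ?r"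
      by (simp only: flip_diff flip_ad_tensor flip_d_flag[OF assms] ad_tensor_neg minus_diff_minus)
  qed
  have components: "?l = ?r \<longleftrightarrow> tensor_map sG sG fst fst ?l = tensor_map sG sG fst fst ?r \<and>
      tensor_map sG sV fst snd ?l = tensor_map sG sV fst snd ?r"
  proof
    assume "?l = ?r"
    then show "tensor_map sG sG fst fst ?l = tensor_map sG sG fst fst ?r \<and>
      tensor_map sG sV fst snd ?l = tensor_map sG sV fst snd ?r"
      by (simp only: simp_thms)
  next
    assume "tensor_map sG sG fst fst ?l = tensor_map sG sG fst fst ?r \<and>
      tensor_map sG sV fst snd ?l = tensor_map sG sV fst snd ?r"
    then show "?l = ?r"
      by (intro skew_tensor_eqI[OF mem]) (simp_all only: l_snd_snd r_snd_snd)
  qed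
  \<comment> \<open>The terms \<alpha>(a) A \<otimes> e occur on both sides, and
    \<open>tensor_line_inject\<close> cancels the factor e from the rest.\<close>
  have fst_snd: "tensor_map sG sV fst snd ?l = tensor_map sG sV fst snd ?r \<longleftrightarrow>
      brG a A = tensor_lift sG (\<lambda>u v. sG (\<alpha> v) u) (dG a)"
    unfolding l_fst_snd r_fst_snd
    by (auto simp: algebra_simps simp del: plus_fun_apply dest: tensor_line_inject)
  have fst_fst: "tensor_map sG sG fst fst ?l = tensor_map sG sG fst fst ?r \<longleftrightarrow>
      tensor sG sG (D a) A - tensor sG sG A (D a) + fscale (\<alpha> a) B + ad_tensor sG brG a B
        + dG (D a) - tensor_map sG sG D id (dG a) - tensor_map sG sG id D (dG a) = 0"
    unfolding l_fst_fst r_fst_fst by (auto simp: algebra_simps simp del: plus_fun_apply)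
  show ?thesis
    unfolding components fst_snd fst_fst by blast
qed

text \<open>The context assumes linearity and membership of B but no axiom of a flag datum, so this
  equivalence serves both to build a system from a datum and to extract a datum from a
  system.\<close>

lemma lie_bialgebra_flag_iff:
  "lie_bialgebra s (br \<Phi>) (d \<Phi>) \<longleftrightarrow> (\<alpha>, D, A, B) \<in> FLB sG brG dG"
proof -
  let ?comp = "\<lambda>u v. d \<Phi> (br \<Phi> u v) = ad_tensor s (br \<Phi>) u (d \<Phi> v) - ad_tensor s (br \<Phi>) v (d \<Phi> u)"
  note ad = ad_tensor_add_left[OF bilin_br_flag d_flag_in] ad_tensor_scale_left[OF bilin_br_flag d_flag_in]
    ad_tensor_add ad_tensor_scale
  note brl = linear_add[OF bilin_fst[OF bilin_br_flag]] linear_scale[OF bilin_fst[OF bilin_br_flag]]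
  note dl = linear_add[OF linear_d_flag] linear_scale[OF linear_d_flag]
  have skew: "br \<Phi> v u = - br \<Phi> u v" for u v
    using lie_bracket_skew[OF lie_bialgebra_G, of "fst v" "fst u"] by (cases u, cases v) simp
  have comp_swap: "?comp v u" if "?comp u v" for u v
    unfolding skew[of v u] linear_neg[OF linear_d_flag] that by (rule minus_diff_eq)
  have comp_add: "?comp (u + u') v" if "?comp u v" "?comp u' v" for u u' v
    unfolding brl dl ad that by (simp only: add_diff_add)
  have comp_scale: "?comp (s c u) v" if "?comp u v" for c u v
    unfolding brl dl ad that by (simp add: fscale_def fun_eq_iff algebra_simps)
  have comp_diag: "?comp u u" for u
    using skew[of u u] linear_0[OF linear_d_flag] by (cases u) (simp add: G(3) zero_prod_def)
  \<comment> \<open>The compatibility identity is bilinear, is preserved by exchanging its arguments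
    and is trivial on the diagonal. It holds on \<gg> because \<gg> is a Lie bialgebra, and on V
    because all vectors are multiples of e; only the mixed pairs carry a condition.\<close>
  have comp_iff: "(\<forall>u v. ?comp u v) \<longleftrightarrow> (\<forall>a. ?comp (a, 0) (0, e))"
  proof
    assume mixed: "\<forall>a. ?comp (a, 0) (0, e)"
    have scale_e: "s (\<xi> x) (0, e) = (0, x)" for x
      by (simp add: s_apply module.scale_zero_right[OF vector_space_module[OF G(1)]])
    have GV: "?comp (a, 0) (0, x)" for a x
      using comp_swap[OF comp_scale[OF comp_swap[OF mixed[rule_format, of a]], of "\<xi> x"]]
      unfolding scale_e .
    have VV: "?comp (0, x) (0, y)" for x y
      using comp_scale[OF comp_swap[OF comp_scale[OF comp_diag, of "\<xi> y" "(0, e)"]], of "\<xi> x"]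
      unfolding scale_e .
    have GG: "?comp (a, 0) (b, 0)" for a b
      by (simp only: br_flag_iG d_flag_iG ad_tensor_iG G(9) tensor_map_diff)
    show "\<forall>u v. ?comp u v"
    proof (intro allI)
      fix u v :: "'g \<times> 'v"
      have uv: "u = (fst u, 0) + (0, snd u)" "v = (fst v, 0) + (0, snd v)"
        by simp_all
      have 1: "?comp (a, x) (b, 0)" for a x b
        using comp_add[OF GG comp_swap[OF GV]] by simp
      have 2: "?comp (a, x) (0, y)" for a x y
        using comp_add[OF GV VV] by simp
      have "?comp (b, y) (a, x)" for a x b y
        using comp_swap[OF comp_add[OF comp_swap[OF 1] comp_swap[OF 2]]] by simp
      then show "?comp u v"
        by (cases u, cases v) blast
    qed
  qed blast
  have "(\<forall>a. ?comp (a, 0) (0, e)) \<longleftrightarrow>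
      (\<forall>a. brG a A = tensor_lift sG (\<lambda>u v. sG (\<alpha> v) u) (dG a)) \<and>
      (\<forall>a. tensor sG sG (D a) A - tensor sG sG A (D a) + fscale (\<alpha> a) B + ad_tensor sG brG a B
        + dG (D a) - tensor_map sG sG D id (dG a) - tensor_map sG sG id D (dG a) = 0)"
    if "flip B = - B"
    by (simp only: compatibility_flag_iff[OF that] all_conj_distrib)
  then show ?thesis
    unfolding lie_bialgebra_def lie_algebra_flag_iff lie_coalgebra_flag_iff comp_iff FLB_def
      mem_Collect_eq prod.case
    using B \<alpha> D by blast
qed

end

section \<open>Flag datums and systems on the line, with their equivalences\<close>

lemma flag_system_LBI_iff:
  assumes "Vector_Spaces.linear sG (*) \<alpha>" "Vector_Spaces.linear sG sG D" "B \<in> tensor_space sG sG"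
  shows "flag_system \<alpha> D A B \<in> LBI sG brG dG sV \<longleftrightarrow> (\<alpha>, D, A, B) \<in> FLB sG brG dG"
  unfolding LBI_def mem_Collect_eq lie_bialgebra_flag_iff[OF assms]
  using flag_system_components[OF assms] by blast

lemma FLB_D:
  assumes "(\<alpha>, D, A, B) \<in> FLB sG brG dG"
  shows "Vector_Spaces.linear sG (*) \<alpha>" "Vector_Spaces.linear sG sG D" "B \<in> tensor_space sG sG"
  using assms by (simp_all add: FLB_def)

lemma flag_system_image:
  "(\<lambda>(\<alpha>, D, A, B). flag_system \<alpha> D A B) ` FLB sG brG dG = LBI sG brG dG sV"
proof
  show "(\<lambda>(\<alpha>, D, A, B). flag_system \<alpha> D A B) ` FLB sG brG dG \<subseteq> LBI sG brG dG sV"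
  proof clarsimp
    fix \<alpha> D A B assume F: "(\<alpha>, D, A, B) \<in> FLB sG brG dG"
    show "flag_system \<alpha> D A B \<in> LBI sG brG dG sV"
      using flag_system_LBI_iff[OF FLB_D[OF F]] F by blast
  qed
  show "LBI sG brG dG sV \<subseteq> (\<lambda>(\<alpha>, D, A, B). flag_system \<alpha> D A B) ` FLB sG brG dG"
  proof
    fix \<Omega> assume \<Omega>: "\<Omega> \<in> LBI sG brG dG sV"
    then obtain \<alpha> D A B where *: "Vector_Spaces.linear sG (*) \<alpha>" "Vector_Spaces.linear sG sG D"
      "B \<in> tensor_space sG sG" and eq: "\<Omega> = flag_system \<alpha> D A B"
      by (rule LBI_eq_flag_system)
    have "(\<alpha>, D, A, B) \<in> FLB sG brG dG"
      using flag_system_LBI_iff[OF *] \<Omega> unfolding eq by blast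
    then show "\<Omega> \<in> (\<lambda>(\<alpha>, D, A, B). flag_system \<alpha> D A B) ` FLB sG brG dG"
      unfolding eq by (intro image_eqI[of _ _ "(\<alpha>, D, A, B)"]) simp_all
  qed
qed

lemma flag_system_equiv_iff:
  assumes F: "(\<alpha>, D, A, B) \<in> FLB sG brG dG" and F': "(\<alpha>', D', A', B') \<in> FLB sG brG dG"
  shows "((\<alpha>, D, A, B), (\<alpha>', D', A', B')) \<in> FLB_equiv sG brG dG \<longleftrightarrow>
    (flag_system \<alpha> D A B, flag_system \<alpha>' D' A' B') \<in> LBI_equiv sG brG dG sV"
proof -
  interpret G: vector_space sG by (rule G(1))
  interpret V: vector_space sV by (rule vector_space_V)
  note \<alpha> = FLB_D(1)[OF F] and D = FLB_D(2)[OF F]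
  note T = tensor_linear[OF G(1) vector_space_V] and TG = tensor_linear[OF G(1) G(1)]
  have idG: "Vector_Spaces.linear sG sG id"
    by (rule linear_id[OF G(1)])
  let ?\<Omega> = "flag_system \<alpha> D A B" and ?\<Omega>' = "flag_system \<alpha>' D' A' B'"
  have mem: "?\<Omega> \<in> LBI sG brG dG sV" "?\<Omega>' \<in> LBI sG brG dG sV"
    using flag_system_LBI_iff[OF FLB_D[OF F]] flag_system_LBI_iff[OF FLB_D[OF F']] F F' by blast+
  \<comment> \<open>These are the conditions that carry information for flag systems; those on
    \<open>delV\<close>, \<open>cocyc\<close> and \<open>brV\<close> hold for all linear p and
    q.\<close>
  let ?C = "\<lambda>p q a x x'.
    tensor sG sV A' x = tensor sG sV A (q x') \<and>
    fscale (\<xi> x) B' = tensor sG sG A (p x') - tensor sG sG (p x') A + fscale (\<xi> x') B - dG (p x') \<and>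
    sV (\<alpha>' a) x = q (sV (\<alpha> a) x') \<and>
    sG (\<xi> x) (D' a) = p (sV (\<alpha> a) x') + sG (\<xi> x') (D a) - brG (p x') a"
  have equiv: "(?\<Omega>, ?\<Omega>') \<in> LBI_equiv sG brG dG sV \<longleftrightarrow>
    (\<exists>p q. Vector_Spaces.linear sV sG p \<and> Vector_Spaces.linear sV sV q \<and> bij q \<and> (\<forall>a x. ?C p q a (q x) x))"
  proof -
    have "(\<forall>a x y. let x' = inv q x; y' = inv q y in
        delV ?\<Omega>' x = tensor_map sV sV q q (delV ?\<Omega> x') \<and>
        DelE ?\<Omega>' x = tensor_map sG sV id q (DelE ?\<Omega> x') + tensor_map sG sV p q (delV ?\<Omega> x') \<and>
        DelV ?\<Omega>' x = tensor_map sG sG id p (DelE ?\<Omega> x') - tensor_map sG sG p id (flip (DelE ?\<Omega> x'))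
          + tensor_map sG sG p p (delV ?\<Omega> x') + DelV ?\<Omega> x' - dG (p x') \<and>
        ract ?\<Omega>' x a = q (ract ?\<Omega> x' a) \<and>
        lact ?\<Omega>' x a = p (ract ?\<Omega> x' a) + lact ?\<Omega> x' a - brG (p x') a \<and>
        cocyc ?\<Omega>' x y = cocyc ?\<Omega> x' y' + p (brV ?\<Omega> x' y') + brG (p x') (p y')
          - p (ract ?\<Omega> x' (p y')) - lact ?\<Omega> x' (p y') + p (ract ?\<Omega> y' (p x')) + lact ?\<Omega> y' (p x') \<and>
        brV ?\<Omega>' x y = q (brV ?\<Omega> x' y') - q (ract ?\<Omega> x' (p y')) + q (ract ?\<Omega> y' (p x'))) \<longleftrightarrow>
      (\<forall>a x. ?C p q a (q x) x)" (is "?L \<longleftrightarrow> ?R")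
      if p: "Vector_Spaces.linear sV sG p" and q: "Vector_Spaces.linear sV sV q" and "bij q" for p q
    proof -
      have inv: "inv q (q x) = x" "q (inv q x) = x" for x
        using \<open>bij q\<close> by (simp_all add: bij_is_inj bij_is_surj surj_f_inv_f)
      have pe: "p x = sG (\<xi> x) (p e)" and qe: "q x = sV (\<xi> x) (q e)" for x
        using linear_scale[OF p, of "\<xi> x" e] linear_scale[OF q, of "\<xi> x" e] by simp_all
      \<comment> \<open>p x and p y are multiples of p e, so their bracket vanishes. The facts
        \<open>comm\<close> use the same proportionality to make the remaining cross terms cancel in
        pairs.\<close>
      have br0: "brG (p x) (p y) = 0" for x y
        by (subst pe, subst (2) pe)
          (simp only: linear_scale[OF bilin_fst[OF G(2)]] linear_scale[OF bilin_snd[OF G(2)]] G(3) G.scale_zero_right)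
      have comm: "sG (\<xi> x) (D (p y)) = sG (\<xi> y) (D (p x))" "sV (\<alpha> (p y)) x = sV (\<alpha> (p x)) y" for x y
      proof -
        show "sG (\<xi> x) (D (p y)) = sG (\<xi> y) (D (p x))"
          by (subst pe, subst (2) pe) (simp add: linear_scale[OF D] mult.commute)
        have "sV (\<alpha> (p y)) (sV (\<xi> x) e) = sV (\<alpha> (p x)) (sV (\<xi> y) e)"
          by (subst pe, subst (2) pe) (simp only: linear_scale[OF \<alpha>] V.scale_scale mult_ac)
        then show "sV (\<alpha> (p y)) x = sV (\<alpha> (p x)) y" by simp
      qed
      have "?L \<longleftrightarrow> (\<forall>a x. ?C p q a x (inv q x))"
        unfolding Let_def flag_system_sel flip_tensor tensor_map_tensor[OF idG p] tensor_map_tensor[OF p idG]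
          tensor_map_tensor[OF idG q] tensor_map_0 br0 linear_0[OF p] linear_0[OF q]
          comm(1)[of "inv q y" "inv q x" for x y] comm(2)[of "inv q y" "inv q x" for x y] id_apply
        by simp
      also have "\<dots> \<longleftrightarrow> ?R"
        by (metis inv)
      finally show ?thesis .
    qed
    then show ?thesis
      unfolding LBI_equiv_def using mem by (simp only: mem_Collect_eq prod.case) blast
  qed
  show ?thesis
  proof
    assume "(?\<Omega>, ?\<Omega>') \<in> LBI_equiv sG brG dG sV"
    then obtain p q where p: "Vector_Spaces.linear sV sG p" and q: "Vector_Spaces.linear sV sV q"
      and "bij q" and C: "?C p q a (q x) x" for a x
      unfolding equiv by blast
    \<comment> \<open>q acts as multiplication by this scalar, and its injectivity will make the
      scalar nonzero.\<close>
    define \<beta> where "\<beta> = \<xi> (q e)"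
    have qe: "q e = sV \<beta> e"
      by (simp add: \<beta>_def)
    have "\<beta> \<noteq> 0"
    proof
      assume "\<beta> = 0"
      then have "q e = q 0"
        by (simp add: qe linear_0[OF q])
      then have "e = 0"
        using injD[OF bij_is_inj[OF \<open>bij q\<close>]] by blast
      then show False
        using \<xi>_e by (simp add: \<xi>_simps)
    qed
    have "tensor sG sV (sG \<beta> A') e = tensor sG sV (sG \<beta> A) e"
      using C[where x = e and a = 0] by (simp only: qe T)
    then have "A' = A"
      using tensor_line_inject[of "sG \<beta> A'" "sG \<beta> A"] \<open>\<beta> \<noteq> 0\<close> by simp
    moreover have "\<alpha>' = \<alpha>"
    proof
      fix a
      have "\<xi> (sV (\<alpha>' a) (q e)) = \<xi> (sV (\<alpha> a) (q e))"
        using C[where x = e and a = a] by (simp only: linear_scale[OF q])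
      then show "\<alpha>' a = \<alpha> a"
        using \<open>\<beta> \<noteq> 0\<close> by (simp add: \<xi>_simps \<beta>_def)
    qed
    moreover have "D a = brG (p e) a + sG \<beta> (D' a) - sG (\<alpha> a) (p e)" for a
      using C[where x = e and a = a] by (simp add: \<beta>_def linear_scale[OF p])
    moreover have "B = dG (p e) + fscale \<beta> B' + tensor sG sG (p e) A - tensor sG sG A (p e)"
    proof -
      have "fscale \<beta> B' = tensor sG sG A (p e) - tensor sG sG (p e) A + fscale 1 B - dG (p e)"
        using C[where x = e and a = 0] by (simp only: \<beta>_def \<xi>_e)
      then show ?thesis
        by (simp add: fscale_def fun_eq_iff)
    qed
    ultimately show "((\<alpha>, D, A, B), (\<alpha>', D', A', B')) \<in> FLB_equiv sG brG dG"
      unfolding FLB_equiv_def using F F' \<open>\<beta> \<noteq> 0\<close> by blast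
  next
    assume "((\<alpha>, D, A, B), (\<alpha>', D', A', B')) \<in> FLB_equiv sG brG dG"
    then obtain U \<beta> where eqs: "\<alpha>' = \<alpha>" "A' = A" and "\<beta> \<noteq> 0"
      and Da: "\<And>a. D a = brG U a + sG \<beta> (D' a) - sG (\<alpha> a) U"
      and Ba: "B = dG U + fscale \<beta> B' + tensor sG sG U A - tensor sG sG A U"
      unfolding FLB_equiv_def by blast
    let ?p = "\<lambda>x. sG (\<xi> x) U" and ?q = "\<lambda>x. sV \<beta> x"
    have p: "Vector_Spaces.linear sV sG ?p" and q: "Vector_Spaces.linear sV sV ?q"
      using G(1) vector_space_V by (simp_all add: linear_iff \<xi>_simps algebra_simps)
    have "bij ?q"
      by (rule bij_betw_byWitness[where f' = "\<lambda>x. sV (1 / \<beta>) x"]) (use \<open>\<beta> \<noteq> 0\<close> in auto)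
    have "?C ?p ?q a (?q x) x" for a x
    proof (intro conjI)
      show "tensor sG sV A' (?q x) = tensor sG sV A (?q x)"
        by (simp only: eqs)
      show "fscale (\<xi> (?q x)) B' = tensor sG sG A (?p x) - tensor sG sG (?p x) A + fscale (\<xi> x) B - dG (?p x)"
        unfolding TG Ba linear_scale[OF G(5)] \<xi>_simps by (simp add: fscale_def fun_eq_iff algebra_simps)
      show "sV (\<alpha>' a) (?q x) = ?q (sV (\<alpha> a) x)"
        by (simp add: eqs mult.commute)
      show "sG (\<xi> (?q x)) (D' a) = ?p (sV (\<alpha> a) x) + sG (\<xi> x) (D a) - brG (?p x) a"
        by (simp add: Da \<xi>_simps linear_scale[OF bilin_fst[OF G(2)]] algebra_simps)
    qed
    then show "(?\<Omega>, ?\<Omega>') \<in> LBI_equiv sG brG dG sV"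
      unfolding equiv using p q \<open>bij ?q\<close> by blast
  qed
qed

lemma FLB_bij_betw_HBI2:
  "\<exists>F. bij_betw F (FLB sG brG dG // FLB_equiv sG brG dG) (HBI2 sG brG dG sV)"
proof -
  have "FLB_equiv sG brG dG \<subseteq> FLB sG brG dG \<times> FLB sG brG dG"
    by (auto simp: FLB_equiv_def)
  moreover have "LBI_equiv sG brG dG sV \<subseteq> LBI sG brG dG sV \<times> LBI sG brG dG sV"
    by (auto simp: LBI_equiv_def)
  moreover have "(f, f') \<in> FLB_equiv sG brG dG \<longleftrightarrow>
      ((\<lambda>(\<alpha>, D, A, B). flag_system \<alpha> D A B) f, (\<lambda>(\<alpha>, D, A, B). flag_system \<alpha> D A B) f') \<in> LBI_equiv sG brG dG sV"
    if "f \<in> FLB sG brG dG" "f' \<in> FLB sG brG dG" for f f'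
    using that by (cases f, cases f') (simp only: prod.case flag_system_equiv_iff)
  ultimately show ?thesis
    unfolding HBI2_def using bij_betw_image_quotients[OF flag_system_image] by blast
qed

end

section \<open>A coordinate on the given complement, and the assembly of the bijections\<close>

lemma complementary_sum:
  assumes "complementary s W C"
  obtains w c where "w \<in> W" "c \<in> C" "u = w + c"
proof -
  have "{w + c | w c. w \<in> W \<and> c \<in> C} = UNIV"
    using assms by (simp only: complementary_def)
  then have "u \<in> {w + c | w c. w \<in> W \<and> c \<in> C}"
    by (simp only: UNIV_I)
  then show thesis
    using that by blast
qed

text \<open>Codimension one only provides some one-dimensional complement C, while V is another.
  Both represent the quotient by W, so a generator of C yields a generator of V modulo W.\<close>

lemma complement_of_codimension_one_line:
  fixes sE :: "'k::field \<Rightarrow> 'e::ab_group_add \<Rightarrow> 'e" and sV :: "'k \<Rightarrow> 'v::ab_group_add \<Rightarrow> 'v"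
  assumes "vector_space sE" "codimension_one sE W" "subspace_embedding sV sE j"
    "complementary sE W (range j)"
  obtains e \<xi> where "Vector_Spaces.linear sV (*) \<xi>" "\<And>x. sV (\<xi> x) e = x" "\<xi> e = (1::'k)"
proof -
  interpret E: vector_space sE by (rule assms(1))
  have j: "Vector_Spaces.linear sV sE j" "inj j"
    using assms(3) by (simp_all add: subspace_embedding_def)
  interpret V: vector_space sV by (rule linear_vector_spaces(1)[OF j(1)])
  obtain C where C: "complementary sE W C" "E.dim C = 1"
    using assms(2) unfolding codimension_one_def by blast
  have sub: "E.subspace W" "W \<inter> C = {0}" "W \<inter> range j = {0}"
    using C(1) assms(4) by (simp_all only: complementary_def)
  obtain b where b: "b \<in> C" "\<And>c. c \<in> C \<Longrightarrow> \<exists>k. c = sE k b" "b \<noteq> 0"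
  proof -
    obtain S where S: "S \<subseteq> C" "E.independent S" "C \<subseteq> E.span S" "card S = 1"
      using E.basis_exists[of C] C(2) by metis
    then obtain b where "S = {b}"
      by (auto simp: card_1_singleton_iff)
    with S show thesis
      using that[of b] by (auto simp: E.span_singleton)
  qed
  \<comment> \<open>e is the V part of the generator b of C; it is nonzero because b would otherwise
    lie in both W and C.\<close>
  obtain w e where we: "w \<in> W" "b = w + j e"
    using complementary_sum[OF assms(4)] by (metis rangeE)
  have "j e \<noteq> 0"
  proof
    assume "j e = 0"
    then have "b \<in> W \<inter> C"
      using we b(1) by simp
    then show False
      using sub(2) b(3) by blast
  qed
  then have "e \<noteq> 0"
    using linear_0[OF j(1)] by auto
  \<comment> \<open>Substituting b = w + j e into j x = w' + k b shows that j maps x - k e into W,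
    which meets the range of j only in 0.\<close>
  have gen: "\<exists>k. x = sV k e" for x
  proof -
    obtain w' c where "w' \<in> W" "c \<in> C" "j x = w' + c"
      using complementary_sum[OF C(1)] by metis
    moreover obtain k where "c = sE k b"
      using b(2) \<open>c \<in> C\<close> by blast
    ultimately have "j (x - sV k e) = w' + sE k w"
      using we(2) by (simp add: linear_diff[OF j(1)] linear_scale[OF j(1)] E.scale_right_distrib)
    moreover have "w' + sE k w \<in> W"
      using sub(1) \<open>w' \<in> W\<close> we(1) by (simp add: E.subspace_add E.subspace_scale)
    ultimately have "j (x - sV k e) = 0"
      using sub(3) by (metis Int_iff rangeI singletonD)
    then have "x - sV k e = 0"
      using linear_0[OF j(1)] injD[OF j(2)] by metis
    then show ?thesis by auto
  qed
  define \<xi> where "\<xi> x = (SOME k. x = sV k e)" for x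
  have \<xi>: "sV (\<xi> x) e = x" for x
    using someI_ex[OF gen[of x]] by (simp add: \<xi>_def)
  have uniq: "\<xi> (sV k e) = k" for k
    using \<xi>[of "sV k e"] \<open>e \<noteq> 0\<close> by simp
  have "\<xi> (x + y) = \<xi> x + \<xi> y" for x y
    using uniq[of "\<xi> x + \<xi> y"] by (simp add: V.scale_left_distrib \<xi>)
  moreover have "\<xi> (sV c x) = c * \<xi> x" for c x
    using uniq[of "c * \<xi> x"] by (simp add: \<xi> flip: V.scale_scale)
  ultimately have "Vector_Spaces.linear sV (*) \<xi>"
    by (simp add: linear_iff V.vector_space_axioms vector_space_mult)
  moreover have "\<xi> e = 1"
    using uniq[of 1] by simp
  ultimately show thesis
    by (intro that[of \<xi> e] \<xi>)
qed

theorem theorem6p4: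
  fixes sG :: "'k::field_char_0 \<Rightarrow> 'g::ab_group_add \<Rightarrow> 'g"
    and brG :: "'g \<Rightarrow> 'g \<Rightarrow> 'g"
    and dG :: "'g \<Rightarrow> ('k, 'g, 'g) tensor2"
    and sE :: "'k \<Rightarrow> 'e::ab_group_add \<Rightarrow> 'e"
    and sV :: "'k \<Rightarrow> 'v::ab_group_add \<Rightarrow> 'v"
    and i :: "'g \<Rightarrow> 'e"
    and j :: "'v \<Rightarrow> 'e"
  assumes "vector_space sE"
    and "lie_bialgebra sG brG dG"
    and "subspace_embedding sG sE i"
    and "codimension_one sE (range i)"
    and "subspace_embedding sV sE j"
    and "complementary sE (range i) (range j)"
  shows "(\<exists>F. bij_betw F (BExtd sG brG dG sE i) (HBI2 sG brG dG sV)) \<and>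
         (\<exists>H. bij_betw H (HBI2 sG brG dG sV) (FLB sG brG dG // FLB_equiv sG brG dG))"
proof -
  have i: "Vector_Spaces.linear sG sE i" "inj i" and j: "Vector_Spaces.linear sV sE j" "inj j"
    using assms(3,5) by (simp_all add: subspace_embedding_def)
  obtain e \<xi> where e: "Vector_Spaces.linear sV (*) \<xi>" "\<And>x. sV (\<xi> x) e = x" "\<xi> e = 1"
    using complement_of_codimension_one_line[OF assms(1,4,5,6)] by blast
  interpret lie_bialgebra_line sG brG dG sV e \<xi>
    by (intro lie_bialgebra_line.intro lie_bialgebra_sum.intro lie_bialgebra_line_axioms.intro
      assms(2) e linear_vector_spaces(1)[OF j(1)])
  let ?\<psi> = "\<lambda>u. i (fst u) + j (snd u)"
  have lin: "Vector_Spaces.linear (sum_scale sG sV) sE ?\<psi>"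
    using i(1) j(1) vector_space_s
    by (simp add: linear_iff s_apply algebra_simps module.scale_right_distrib[OF vector_space_module])
  have "bij ?\<psi>"
  proof (rule bijI)
    show "inj ?\<psi>"
    proof (rule injI)
      fix u v assume "?\<psi> u = ?\<psi> v"
      then have "i (fst u - fst v) = j (snd v - snd u)"
        by (simp add: linear_diff[OF i(1)] linear_diff[OF j(1)] algebra_simps)
      moreover have "range i \<inter> range j = {0}"
        using assms(6) by (simp add: complementary_def)
      ultimately have "i (fst u - fst v) = i 0" "j (snd v - snd u) = j 0"
        using linear_0[OF i(1)] linear_0[OF j(1)] by (metis Int_iff rangeI singletonD)+
      then show "u = v"
        using i(2) j(2) by (simp add: inj_eq prod_eq_iff)
    qed
    show "surj ?\<psi>"
    proof (rule surjI)
      fix u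
      obtain a x where "u = i a + j x"
        using complementary_sum[OF assms(6)] by (metis rangeE)
      then show "?\<psi> (SOME v. ?\<psi> v = u) = u"
        by (intro someI[of "\<lambda>v. ?\<psi> v = u" "(a, x)"]) simp
    qed
  qed
  moreover have "i a = ?\<psi> (a, 0)" for a
    using linear_0[OF j(1)] by simp
  ultimately obtain F where F: "bij_betw F (HBI2 sG brG dG sV) (BExtd sG brG dG sE i)"
    using HBI2_bij_betw_BExtd[OF lin] by blast
  obtain H where H: "bij_betw H (FLB sG brG dG // FLB_equiv sG brG dG) (HBI2 sG brG dG sV)"
    using FLB_bij_betw_HBI2 by blast
  \<comment> \<open>Both bijections were constructed opposite to the direction stated, so their
    inverses are taken.\<close>
  show ?thesis
    using bij_betw_inv_into[OF F] bij_betw_inv_into[OF H] by blast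
qed

end
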